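(* Let $\{X_k,k\in\mathbb{N}\}$ be a standardized Gaussian process. The following statements are equivalent: (i) $\{X_k,k\in\mathbb{N}\}$ are weakly dependent normal variables, i.e. $\Delta(n)=o(n^2)$ as $n\to\infty$; (ii) for every $\epsilon>0$, $\displaystyle\lim_{n\to\infty}\sup_{t\in\mathbb{R}}P\left(\left|\widehat{F}_n(t)-\mathbf{E}\widehat{F}_n(t)\right|>\epsilon\right)=0$; (iii) for every $\epsilon>0$, $\displaystyle\lim_{n\to\infty}P\left(\sup_{t\in\mathbb{R}}\left|\widehat{F}_n(t)-\mathbf{E}\widehat{F}_n(t)\right|>\epsilon\right)=0$.
   Context: Here $\mathbb{N}=\{1,2,3,\dots\}$. A stochastic process $\{X_k,k\in\mathbb{N}\}$ of real random variables on a common probability space is a Gaussian process if for every finite set of indices $\{k_1,\dots,k_m\}$, $m\ge 1$, the joint distribution of $(X_{k_1},\dots,X_{k_m})$ is multivariate Gaussian (possibly degenerate). It is a standardized Gaussian process if in addition $X_k\sim\mathcal{N}(0,1)$ for every $k\in\mathbb{N}$. Let $\Phi$ be the cumulative distribution function of the standard Gaussian $\mathcal{N}(0,1)$. The empirical distribution is $$\widehat{F}_n(t)=\frac1n\sum_{i=1}^n\mathbf{1}(\Phi(X_i)\le t),\qquad t\in\mathbb{R},$$ where $\mathbf{1}(A)$ is the indicator of the event $A$. The dependence measure is $$\Delta(n)=2\sum_{1\le i<j\le n}|\mathrm{Cov}(X_i,X_j)|.$$ Jointly normal standard Gaussian random variables with $\Delta(n)=o(n^2)$ are called weakly dependent normal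 variables. *)

theory Defs
  imports "HOL-Probability.Probability" "HOL-Library.Landau_Symbols"
begin

text \<open>
  The normal distribution with mean \<open>\<mu>\<close> and standard deviation \<open>\<sigma> \<ge> 0\<close>. The library's
  \<^const>\<open>normal_density\<close> is identically 0 for \<open>\<sigma> = 0\<close>, so the degenerate case, a point mass,
  is separate.
\<close>
definition normal_distribution :: "real \<Rightarrow> real \<Rightarrow> real measure" where
  "normal_distribution \<mu> \<sigma> =
     (if \<sigma> = 0 then return borel \<mu> else density lborel (\<lambda>x. ennreal (normal_density \<mu> \<sigma> x)))"

text \<open>
  A multivariate normal distribution, possibly degenerate, on vectors indexed by the finite set
  \<open>J\<close>: every linear combination of the coordinates is normal or constant.
\<close>
definition multivariate_normal :: "'i set \<Rightarrow> ('i \<Rightarrow> real) measure \<Rightarrow> bool" where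
  "multivariate_normal J N \<longleftrightarrow>
     sets N = sets (Pi\<^sub>M J (\<lambda>_. borel)) \<and>
     (\<forall>a :: 'i \<Rightarrow> real. \<exists>\<mu> \<sigma>. \<sigma> \<ge> 0 \<and>
        distr N borel (\<lambda>x. \<Sum>k\<in>J. a k * x k) = normal_distribution \<mu> \<sigma>)"

text \<open>Processes are indexed by the positive integers; the value at index 0 is irrelevant.\<close>
definition gaussian_process :: "'a measure \<Rightarrow> (nat \<Rightarrow> 'a \<Rightarrow> real) \<Rightarrow> bool" where
  "gaussian_process M X \<longleftrightarrow>
     (\<forall>k\<ge>1. X k \<in> borel_measurable M) \<and>
     (\<forall>J. finite J \<and> J \<noteq> {} \<and> J \<subseteq> {1..} \<longrightarrow>
        multivariate_normal J (distr M (Pi\<^sub>M J (\<lambda>_. borel)) (\<lambda>\<omega>. \<lambda>k\<in>J. X k \<omega>)))"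

definition standardized_gaussian_process :: "'a measure \<Rightarrow> (nat \<Rightarrow> 'a \<Rightarrow> real) \<Rightarrow> bool" where
  "standardized_gaussian_process M X \<longleftrightarrow>
     gaussian_process M X \<and> (\<forall>k\<ge>1. distr M borel (X k) = std_normal_distribution)"

definition std_normal_cdf :: "real \<Rightarrow> real" where
  "std_normal_cdf = cdf std_normal_distribution"

definition empirical_distribution :: "(nat \<Rightarrow> 'a \<Rightarrow> real) \<Rightarrow> nat \<Rightarrow> real \<Rightarrow> 'a \<Rightarrow> real" where
  "empirical_distribution X n t \<omega> =
     (1 / real n) * (\<Sum>i=1..n. of_bool (std_normal_cdf (X i \<omega>) \<le> t))"

definition covariance :: "'a measure \<Rightarrow> ('a \<Rightarrow> real) \<Rightarrow> ('a \<Rightarrow> real) \<Rightarrow> real" where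
  "covariance M Y Z =
     (\<integral>\<omega>. (Y \<omega> - (\<integral>\<xi>. Y \<xi> \<partial>M)) * (Z \<omega> - (\<integral>\<xi>. Z \<xi> \<partial>M)) \<partial>M)"

definition dependence_measure :: "'a measure \<Rightarrow> (nat \<Rightarrow> 'a \<Rightarrow> real) \<Rightarrow> nat \<Rightarrow> real" where
  "dependence_measure M X n =
     2 * (\<Sum>(i, j) \<in> {(i, j). 1 \<le> i \<and> i < j \<and> j \<le> n}. \<bar>covariance M (X i) (X j)\<bar>)"

definition weakly_dependent_normal :: "'a measure \<Rightarrow> (nat \<Rightarrow> 'a \<Rightarrow> real) \<Rightarrow> bool" where
  "weakly_dependent_normal M X \<longleftrightarrow>
     standardized_gaussian_process M X \<and>
     dependence_measure M X \<in> o(\<lambda>n. (real n)\<^sup>2)"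

end

theory Submission
  imports Defs
begin

text \<open>
  Write \<open>\<gamma>\<close> for the standard normal law and \<open>\<rho>\<close> for the covariances of the process. Consider the functions
  \<open>g \<in> L\<^sup>1(\<gamma>)\<close> whose sample means \<open>(g(X\<^sub>1) + \<dots> + g(X\<^sub>n)) / n\<close> converge in mean to \<open>\<integral> g d\<gamma>\<close>. All \<open>X\<^sub>i\<close> have law \<open>\<gamma>\<close>,
  so these functions form a closed linear subspace of \<open>L\<^sup>1(\<gamma>)\<close>, whatever the dependence between the variables.
  It contains all of \<open>L\<^sup>1(\<gamma>)\<close> as soon as it contains a family with dense span. There are two such families: the
  indicators of half-lines, which are what the empirical distribution tests, and the sinusoids
  \<open>x \<mapsto> cos (\<theta> x + c)\<close>, which see the covariances.

  Sinusoids are convenient because the mean of the cosine of a linear combination \<open>a X\<^sub>i + b X\<^sub>j\<close> only depends on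
  the variance of that combination. This yields the covariance of \<open>cos (\<theta> X\<^sub>i + c)\<close> and \<open>cos (\<theta> X\<^sub>j + c)\<close> in closed
  form (\<open>wave_covariance\<close>). It is at most \<open>\<theta>\<^sup>2 \<bar>\<rho>\<^sub>i\<^sub>j\<bar>\<close> in absolute value, and for \<open>\<theta> = 1\<close>, \<open>c = 0\<close> it equals
  \<open>(cosh \<rho>\<^sub>i\<^sub>j - 1) / e\<close>, which is at least \<open>\<rho>\<^sub>i\<^sub>j\<^sup>2 / (2 e)\<close>.

  Under weak dependence the first bound makes the variance of every sample mean of sinusoids tend to zero. Hence all of
  \<open>L\<^sup>1(\<gamma>)\<close> obeys the law of large numbers (\<open>half_line_lln\<close>, \<open>obeys_lln_integrable\<close>). In particular the empirical
  distribution converges at each \<open>t\<close>, and monotonicity makes the convergence uniform in \<open>t\<close>, as in the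
  Glivenko--Cantelli theorem (\<open>dev_le_grid\<close>). Uniform convergence trivially implies convergence at each \<open>t\<close>
  once the supremum is known to be measurable. Conversely, convergence at each \<open>t\<close> gives the law of large numbers for
  the indicators of half-lines, hence for the cosine, and the second bound with the Cauchy--Schwarz inequality forces the average
  of \<open>\<bar>\<rho>\<^sub>i\<^sub>j\<bar>\<close> to vanish (\<open>cos_lln_imp_weakly_dependent\<close>).
\<close>

section \<open>The mean-error law of large numbers for identically distributed variables\<close>

locale identically_distributed = prob_space M
  for M :: "'a measure" +
  fixes X :: "nat \<Rightarrow> 'a \<Rightarrow> real" and \<gamma> :: "real measure"
  assumes measurable_X: "k \<ge> 1 \<Longrightarrow> X k \<in> borel_measurable M"
    and distr_X: "k \<ge> 1 \<Longrightarrow> distr M borel (X k) = \<gamma>"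
begin

definition sample_error :: "nat \<Rightarrow> (real \<Rightarrow> real) \<Rightarrow> 'a \<Rightarrow> real" where
  "sample_error n g \<omega> = (\<Sum>i=1..n. g (X i \<omega>)) / real n - (\<integral>x. g x \<partial>\<gamma>)"

text \<open>
  Convergence is taken in \<open>L\<^sup>1\<close> rather than in probability or in \<open>L\<^sup>2\<close>: the triangle inequality then
  makes the class of these \<open>g\<close> a linear subspace, and \<open>mean_error_le\<close> makes it closed.
\<close>
definition obeys_lln :: "(real \<Rightarrow> real) \<Rightarrow> bool" where
  "obeys_lln g \<longleftrightarrow> integrable \<gamma> g \<and> (\<lambda>n. \<integral>\<omega>. \<bar>sample_error n g \<omega>\<bar> \<partial>M) \<longlonglongrightarrow> 0"

lemma law_is_real_distribution: "real_distribution \<gamma>"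
  using prob_space_distr[OF measurable_X, of 1] distr_X[of 1]
  by (metis real_distribution_axioms.intro real_distribution_def order_refl sets_distr space_distr space_borel)

sublocale law: real_distribution \<gamma>
  by (rule law_is_real_distribution)

lemma measurable_law: "borel_measurable \<gamma> = borel_measurable borel"
  by (rule measurable_cong_sets) auto

lemma integrable_comp:
  fixes g :: "real \<Rightarrow> real"
  assumes "integrable \<gamma> g" "k \<ge> 1"
  shows "integrable M (\<lambda>\<omega>. g (X k \<omega>))"
  using assms integrable_distr[OF measurable_X, of k g] distr_X[of k] by simp

lemma integral_comp:
  fixes g :: "real \<Rightarrow> real"
  assumes "g \<in> borel_measurable borel" "k \<ge> 1"
  shows "(\<integral>\<omega>. g (X k \<omega>) \<partial>M) = (\<integral>x. g x \<partial>\<gamma>)"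
  using assms integral_distr[OF measurable_X, of k g] distr_X[of k] by simp

lemma integrable_sample_error:
  assumes "integrable \<gamma> g"
  shows "integrable M (sample_error n g)"
  unfolding sample_error_def[abs_def]
  by (intro Bochner_Integration.integrable_diff integrable_divide_zero Bochner_Integration.integrable_sum
      integrable_comp[OF assms]) auto

lemma sample_error_add:
  assumes "integrable \<gamma> f" "integrable \<gamma> g"
  shows "sample_error n (\<lambda>x. f x + g x) \<omega> = sample_error n f \<omega> + sample_error n g \<omega>"
  using assms by (simp add: sample_error_def sum.distrib add_divide_distrib)

lemma sample_error_scale: "sample_error n (\<lambda>x. c * f x) \<omega> = c * sample_error n f \<omega>"
  by (simp add: sample_error_def sum_distrib_left right_diff_distrib)

lemma mean_error_add:
  assumes f: "integrable \<gamma> f" and g: "integrable \<gamma> g"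
  shows "(\<integral>\<omega>. \<bar>sample_error n (\<lambda>x. f x + g x) \<omega>\<bar> \<partial>M)
    \<le> (\<integral>\<omega>. \<bar>sample_error n f \<omega>\<bar> \<partial>M) + (\<integral>\<omega>. \<bar>sample_error n g \<omega>\<bar> \<partial>M)"
proof -
  have "(\<integral>\<omega>. \<bar>sample_error n (\<lambda>x. f x + g x) \<omega>\<bar> \<partial>M)
      \<le> (\<integral>\<omega>. \<bar>sample_error n f \<omega>\<bar> + \<bar>sample_error n g \<omega>\<bar> \<partial>M)"
    using integrable_sample_error[OF f] integrable_sample_error[OF g] integrable_sample_error[of "\<lambda>x. f x + g x"] f g
    by (intro integral_mono) (auto simp: sample_error_add)
  then show ?thesis
    using integrable_sample_error[OF f] integrable_sample_error[OF g] by simp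
qed

text \<open>
  Every \<open>X i\<close> has law \<open>\<gamma>\<close>, whatever the dependence, so passing from \<open>g\<close> to an \<open>L\<^sup>1(\<gamma>)\<close>-close function
  costs little, uniformly in the sample size.
\<close>
lemma mean_error_le:
  assumes "integrable \<gamma> g"
  shows "(\<integral>\<omega>. \<bar>sample_error n g \<omega>\<bar> \<partial>M) \<le> 2 * (\<integral>x. \<bar>g x\<bar> \<partial>\<gamma>)"
proof -
  let ?m = "\<integral>x. \<bar>g x\<bar> \<partial>\<gamma>"
  have g: "integrable \<gamma> (\<lambda>x. \<bar>g x\<bar>)" "(\<lambda>x. \<bar>g x\<bar>) \<in> borel_measurable borel"
    using assms borel_measurable_integrable[of \<gamma> g] by (auto simp: measurable_law)
  have "\<bar>sample_error n g \<omega>\<bar> \<le> (\<Sum>i=1..n. \<bar>g (X i \<omega>)\<bar>) / n + ?m" for \<omega>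
  proof -
    have "\<bar>sample_error n g \<omega>\<bar> \<le> \<bar>(\<Sum>i=1..n. g (X i \<omega>)) / n\<bar> + \<bar>\<integral>x. g x \<partial>\<gamma>\<bar>"
      unfolding sample_error_def by linarith
    moreover have "\<bar>(\<Sum>i=1..n. g (X i \<omega>)) / n\<bar> \<le> (\<Sum>i=1..n. \<bar>g (X i \<omega>)\<bar>) / n"
      by (simp add: divide_right_mono sum_abs)
    moreover have "\<bar>\<integral>x. g x \<partial>\<gamma>\<bar> \<le> ?m" by (rule integral_abs_bound)
    ultimately show ?thesis by linarith
  qed
  then have "(\<integral>\<omega>. \<bar>sample_error n g \<omega>\<bar> \<partial>M) \<le> (\<integral>\<omega>. (\<Sum>i=1..n. \<bar>g (X i \<omega>)\<bar>) / n + ?m \<partial>M)"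
    using integrable_sample_error[OF assms]
    by (intro integral_mono integrable_abs Bochner_Integration.integrable_add integrable_divide_zero
        Bochner_Integration.integrable_sum integrable_comp[OF g(1)]) auto
  also have "\<dots> = (\<Sum>i=1..n. (\<integral>\<omega>. \<bar>g (X i \<omega>)\<bar> \<partial>M)) / n + ?m"
  proof -
    have "has_bochner_integral M (\<lambda>\<omega>. (\<Sum>i=1..n. \<bar>g (X i \<omega>)\<bar>) / n + ?m)
        ((\<Sum>i=1..n. (\<integral>\<omega>. \<bar>g (X i \<omega>)\<bar> \<partial>M)) / n + measure M (space M) * ?m)"
      by (intro has_bochner_integral_add has_bochner_integral_divide_zero has_bochner_integral_sum
          has_bochner_integral_integrable integrable_comp[OF g(1)]) (auto simp: has_bochner_integral_iff)
    then show ?thesis by (simp add: has_bochner_integral_integral_eq prob_space)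
  qed
  also have "\<dots> = (\<Sum>i=1..n. ?m) / n + ?m"
    using integral_comp[OF g(2)] by simp
  also have "\<dots> \<le> 2 * ?m"
    by (cases "n = 0") simp_all
  finally show ?thesis .
qed

lemma obeys_lln_scale:
  assumes "obeys_lln f" shows "obeys_lln (\<lambda>x. c * f x)"
proof -
  have "(\<lambda>n. \<bar>c\<bar> * (\<integral>\<omega>. \<bar>sample_error n f \<omega>\<bar> \<partial>M)) \<longlonglongrightarrow> \<bar>c\<bar> * 0"
    using assms unfolding obeys_lln_def by (intro tendsto_intros) auto
  then show ?thesis
    using assms unfolding obeys_lln_def by (simp add: sample_error_scale abs_mult)
qed

lemma obeys_lln_add:
  assumes "obeys_lln f" "obeys_lln g" shows "obeys_lln (\<lambda>x. f x + g x)"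
proof -
  have f: "integrable \<gamma> f" "(\<lambda>n. \<integral>\<omega>. \<bar>sample_error n f \<omega>\<bar> \<partial>M) \<longlonglongrightarrow> 0"
    and g: "integrable \<gamma> g" "(\<lambda>n. \<integral>\<omega>. \<bar>sample_error n g \<omega>\<bar> \<partial>M) \<longlonglongrightarrow> 0"
    using assms by (simp_all add: obeys_lln_def)
  have "\<forall>n. norm (\<integral>\<omega>. \<bar>sample_error n (\<lambda>x. f x + g x) \<omega>\<bar> \<partial>M)
      \<le> (\<integral>\<omega>. \<bar>sample_error n f \<omega>\<bar> \<partial>M) + (\<integral>\<omega>. \<bar>sample_error n g \<omega>\<bar> \<partial>M)"
    using mean_error_add[OF f(1) g(1)] by simp
  from Lim_null_comparison[OF always_eventually[OF this]] tendsto_add[OF f(2) g(2)]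
  have "(\<lambda>n. \<integral>\<omega>. \<bar>sample_error n (\<lambda>x. f x + g x) \<omega>\<bar> \<partial>M) \<longlonglongrightarrow> 0"
    by simp
  then show ?thesis using f(1) g(1) by (simp add: obeys_lln_def)
qed

lemma obeys_lln_const: "obeys_lln (\<lambda>x. c)"
proof -
  have "eventually (\<lambda>n. (\<integral>\<omega>. \<bar>sample_error n (\<lambda>x. c) \<omega>\<bar> \<partial>M) = 0) sequentially"
    using eventually_gt_at_top[of 0]
    by eventually_elim (use law.prob_space in \<open>simp add: sample_error_def\<close>)
  then show ?thesis
    unfolding obeys_lln_def by (auto intro: tendsto_eventually)
qed

lemma obeys_lln_diff:
  assumes "obeys_lln f" "obeys_lln g" shows "obeys_lln (\<lambda>x. f x - g x)"
  using obeys_lln_add[OF assms(1) obeys_lln_scale[OF assms(2), of "-1"]] by simp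

lemma obeys_lln_sum:
  assumes "\<And>i. i \<in> I \<Longrightarrow> obeys_lln (f i)" shows "obeys_lln (\<lambda>x. \<Sum>i\<in>I. f i x)"
  using assms
  by (induction I rule: infinite_finite_induct) (auto intro: obeys_lln_const obeys_lln_add)

text \<open>
  The bound of \<open>mean_error_le\<close> does not depend on the sample size, so the class is closed in \<open>L\<^sup>1(\<gamma>)\<close>.
\<close>
lemma obeys_lln_approx:
  assumes g: "integrable \<gamma> g"
    and approx: "\<And>e. e > 0 \<Longrightarrow> \<exists>h. obeys_lln h \<and> (\<integral>x. \<bar>g x - h x\<bar> \<partial>\<gamma>) < e"
  shows "obeys_lln g"
proof -
  have "(\<lambda>n. \<integral>\<omega>. \<bar>sample_error n g \<omega>\<bar> \<partial>M) \<longlonglongrightarrow> 0"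
  proof (rule LIMSEQ_I)
    fix e :: real assume "e > 0"
    then obtain h where h: "obeys_lln h" and close: "(\<integral>x. \<bar>g x - h x\<bar> \<partial>\<gamma>) < e / 4"
      using approx[of "e / 4"] by auto
    have hi: "integrable \<gamma> h" using h by (simp add: obeys_lln_def)
    obtain N where N: "\<And>n. n \<ge> N \<Longrightarrow> (\<integral>\<omega>. \<bar>sample_error n h \<omega>\<bar> \<partial>M) < e / 2"
      using h \<open>e > 0\<close> LIMSEQ_D[of "\<lambda>n. \<integral>\<omega>. \<bar>sample_error n h \<omega>\<bar> \<partial>M" 0 "e / 2"]
      unfolding obeys_lln_def by auto
    have "(\<integral>\<omega>. \<bar>sample_error n g \<omega>\<bar> \<partial>M) < e" if "n \<ge> N" for n
    proof -
      have "(\<integral>\<omega>. \<bar>sample_error n g \<omega>\<bar> \<partial>M) \<le> (\<integral>\<omega>. \<bar>sample_error n h \<omega>\<bar> \<partial>M)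
          + (\<integral>\<omega>. \<bar>sample_error n (\<lambda>x. g x - h x) \<omega>\<bar> \<partial>M)"
        using mean_error_add[OF hi, of "\<lambda>x. g x - h x" n] g hi by simp
      moreover have "(\<integral>\<omega>. \<bar>sample_error n (\<lambda>x. g x - h x) \<omega>\<bar> \<partial>M) \<le> 2 * (\<integral>x. \<bar>g x - h x\<bar> \<partial>\<gamma>)"
        using mean_error_le[of "\<lambda>x. g x - h x" n] g hi by simp
      ultimately show ?thesis using N[OF that] close by linarith
    qed
    then show "\<exists>N. \<forall>n\<ge>N. norm ((\<integral>\<omega>. \<bar>sample_error n g \<omega>\<bar> \<partial>M) - 0) < e" by auto
  qed
  then show ?thesis using g by (simp add: obeys_lln_def)
qed

lemma obeys_lln_dominated:
  assumes s: "\<And>k. obeys_lln (s k)" and lim: "\<And>x. (\<lambda>k. s k x) \<longlonglongrightarrow> g x"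
    and w: "integrable \<gamma> w" "\<And>k x. \<bar>s k x\<bar> \<le> w x"
  shows "obeys_lln g"
proof -
  have si: "integrable \<gamma> (s k)" for k using s by (simp add: obeys_lln_def)
  have gm: "g \<in> borel_measurable \<gamma>"
    by (rule borel_measurable_LIMSEQ_real[OF lim]) (use si in auto)
  have gi: "integrable \<gamma> g"
    by (rule integrable_dominated_convergence[where s = s and w = w]) (use gm si w lim in auto)
  have gw: "\<bar>g x\<bar> \<le> w x" for x
    by (rule LIMSEQ_le_const2[OF tendsto_rabs[OF lim[of x]]]) (use w in auto)
  have "(\<lambda>k. \<integral>x. \<bar>g x - s k x\<bar> \<partial>\<gamma>) \<longlonglongrightarrow> (\<integral>x. 0 \<partial>\<gamma>)"
  proof (rule integral_dominated_convergence[where w = "\<lambda>x. 2 * w x"])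
    show "AE x in \<gamma>. (\<lambda>k. \<bar>g x - s k x\<bar>) \<longlonglongrightarrow> 0"
    proof (rule AE_I2)
      fix x show "(\<lambda>k. \<bar>g x - s k x\<bar>) \<longlonglongrightarrow> 0"
        using tendsto_rabs[OF tendsto_diff[OF tendsto_const lim[of x], of "g x"]] by simp
    qed
    show "AE x in \<gamma>. norm \<bar>g x - s k x\<bar> \<le> 2 * w x" for k
    proof (rule AE_I2)
      fix x show "norm \<bar>g x - s k x\<bar> \<le> 2 * w x"
        using gw[of x] w(2)[of k x] by (auto simp: abs_le_iff)
    qed
  qed (use gm si w in auto)
  then have to0: "(\<lambda>k. \<integral>x. \<bar>g x - s k x\<bar> \<partial>\<gamma>) \<longlonglongrightarrow> 0" by simp
  show ?thesis
  proof (rule obeys_lln_approx[OF gi])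
    fix e :: real assume "e > 0"
    then have "eventually (\<lambda>k. (\<integral>x. \<bar>g x - s k x\<bar> \<partial>\<gamma>) < e) sequentially"
      using to0 order_tendstoD(2) by blast
    then show "\<exists>h. obeys_lln h \<and> (\<integral>x. \<bar>g x - h x\<bar> \<partial>\<gamma>) < e"
      using s by (auto simp: eventually_sequentially)
  qed
qed

text \<open>
  The sets whose indicators obey the law form a Dynkin system, by linearity and dominated convergence.
  The half-lines are an intersection-stable generator of the Borel sets, and simple functions are
  dense in \<open>L\<^sup>1(\<gamma>)\<close>.
\<close>
lemma obeys_lln_integrable:
  assumes half_lines: "\<And>a. obeys_lln (indicator {..a})" and f: "integrable \<gamma> f"
  shows "obeys_lln f"
proof -
  have sets: "obeys_lln (indicator A)" if "A \<in> sets borel" for A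
  proof -
    have "Int_stable (range (\<lambda>a::real. {..a}))"
      by (auto simp: Int_stable_def)
    moreover have "range (\<lambda>a::real. {..a}) \<subseteq> Pow UNIV" by simp
    moreover have "A \<in> sigma_sets UNIV (range (\<lambda>a::real. {..a}))"
      using that unfolding borel_eq_atMost by simp
    ultimately show ?thesis
    proof (induction rule: sigma_sets_induct_disjoint)
      case (basic A) then show ?case using half_lines by auto
    next
      case empty then show ?case using obeys_lln_const[of 0] by (simp add: indicator_def)
    next
      case (compl A)
      have "(indicator (UNIV - A) :: real \<Rightarrow> real) = (\<lambda>x. 1 - indicator A x)"
        by (auto simp: indicator_def fun_eq_iff)
      then show ?case using obeys_lln_diff[OF obeys_lln_const[of 1] compl(2)] by simp
    next
      case (union A)
      show ?case
      proof (rule obeys_lln_dominated[where w = "\<lambda>_. 1" and s = "\<lambda>k x. \<Sum>i<k. indicator (A i) x"])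
        show "obeys_lln (\<lambda>x. \<Sum>i<k. indicator (A i) x)" for k
          using union by (intro obeys_lln_sum) auto
        show "(\<lambda>k. \<Sum>i<k. indicator (A i) x) \<longlonglongrightarrow> (indicator (\<Union> (range A)) x :: real)" for x
          using indicator_sums[of A x] union(1) unfolding sums_def disjoint_family_on_def by auto
        show "\<bar>\<Sum>i<k. indicator (A i) x\<bar> \<le> (1::real)" for k x
        proof -
          have "(\<Sum>i<k. indicator (A i) x) = (indicator (\<Union>i<k. A i) x :: real)"
            using union(1)
            by (subst indicator_UN_disjoint) (auto simp: disjoint_family_on_def)
          then show ?thesis by (simp add: indicator_def)
        qed
      qed simp
    qed
  qed
  from f show ?thesis
  proof (induction rule: integrable_induct)
    case (base A c)
    then show ?case using obeys_lln_scale[OF sets[of A], of c] by (simp add: mult.commute)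
  next
    case (add f g) then show ?case by (simp add: obeys_lln_add)
  next
    case (lim f s)
    show ?case
      by (rule obeys_lln_dominated[where s = s and w = "\<lambda>x. 2 * \<bar>f x\<bar>"]) (use lim in auto)
  qed
qed

text \<open>
  The product formulas turn a product of sinusoids into a linear combination of sinusoids, so an
  induction on the power reduces to the hypothesis. This supplies all polynomials in \<open>sin (s * x + d)\<close>
  (take \<open>\<theta> = c = 0\<close>).
\<close>
lemma sin_power_wave_lln:
  assumes waves: "\<And>\<theta> c. obeys_lln (\<lambda>x. cos (\<theta> * x + c))"
  shows "obeys_lln (\<lambda>x. sin (s * x + d) ^ k * cos (\<theta> * x + c))"
proof (induction k arbitrary: \<theta> c)
  case 0 then show ?case by (simp add: waves)
next
  case (Suc k)
  have product: "sin u * cos v = (1/2) * (cos ((v + u) - pi / 2) - cos ((v - u) - pi / 2))" for u v :: real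
  proof -
    have "cos (w - pi / 2) = sin w" for w :: real by (simp add: cos_diff)
    then show ?thesis by (simp add: sin_add sin_diff)
  qed
  have "sin (s * x + d) ^ Suc k * cos (\<theta> * x + c) = (1/2) *
      (sin (s * x + d) ^ k * cos ((\<theta> + s) * x + (c + d - pi / 2))
       - sin (s * x + d) ^ k * cos ((\<theta> - s) * x + (c - d - pi / 2)))" for x
  proof -
    have phases: "(\<theta> * x + c) + (s * x + d) - pi / 2 = (\<theta> + s) * x + (c + d - pi / 2)"
      "(\<theta> * x + c) - (s * x + d) - pi / 2 = (\<theta> - s) * x + (c - d - pi / 2)"
      by (simp_all add: algebra_simps)
    then show ?thesis
      using product[of "s * x + d" "\<theta> * x + c"] unfolding phases
      by (simp only: power_Suc2 mult.assoc) (simp add: right_diff_distrib)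
  qed
  then show ?case
    using obeys_lln_scale[OF obeys_lln_diff[OF Suc.IH Suc.IH], of "1/2"] by presburger
qed

lemma obeys_lln_uniform_approx:
  assumes g: "g \<in> borel_measurable borel"
    and approx: "\<And>e. e > 0 \<Longrightarrow> \<exists>h. obeys_lln h \<and> (\<forall>x. \<bar>g x - h x\<bar> < e)"
  shows "obeys_lln g"
proof -
  obtain h0 where h0: "obeys_lln h0" "\<And>x. \<bar>g x - h0 x\<bar> < 1" using approx[of 1] by auto
  have gi: "integrable \<gamma> g"
  proof (rule Bochner_Integration.integrable_bound[of _ "\<lambda>x. \<bar>h0 x\<bar> + 1"])
    show "AE x in \<gamma>. norm (g x) \<le> norm (\<bar>h0 x\<bar> + 1)"
    proof (rule AE_I2)
      fix x show "norm (g x) \<le> norm (\<bar>h0 x\<bar> + 1)" using h0(2)[of x] by auto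
    qed
  qed (use h0 g in \<open>auto simp: obeys_lln_def measurable_law\<close>)
  show ?thesis
  proof (rule obeys_lln_approx[OF gi])
    fix e :: real assume "e > 0"
    then obtain h where h: "obeys_lln h" "\<And>x. \<bar>g x - h x\<bar> < e / 2" using approx[of "e / 2"] by auto
    have "(\<integral>x. \<bar>g x - h x\<bar> \<partial>\<gamma>) \<le> (\<integral>x. e / 2 \<partial>\<gamma>)"
      using gi h less_imp_le[OF h(2)] by (intro integral_mono) (auto simp: obeys_lln_def)
    also have "\<dots> < e" using \<open>e > 0\<close> law.prob_space by simp
    finally show "\<exists>h. obeys_lln h \<and> (\<integral>x. \<bar>g x - h x\<bar> \<partial>\<gamma>) < e" using h(1) by auto
  qed
qed

text \<open>
  Weierstrass approximation on \<open>[-1, 1]\<close> is uniform on the whole real line after composition with the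
  sine, so the tails of \<open>\<gamma>\<close> need no separate estimate.
\<close>
lemma continuous_of_sin_lln:
  assumes waves: "\<And>\<theta> c. obeys_lln (\<lambda>x. cos (\<theta> * x + c))"
    and q: "continuous_on UNIV q"
  shows "obeys_lln (\<lambda>x. q (sin (s * x + d)))"
proof (rule obeys_lln_uniform_approx)
  show "(\<lambda>x. q (sin (s * x + d))) \<in> borel_measurable borel"
    using q by (intro borel_measurable_continuous_onI continuous_on_compose2[OF q] continuous_intros) auto
  fix e :: real assume "e > 0"
  obtain p where p: "real_polynomial_function p" "\<And>u. u \<in> {-1..1} \<Longrightarrow> \<bar>q u - p u\<bar> < e"
    using Stone_Weierstrass_real_polynomial_function[of "{-1..1::real}" q e] \<open>e > 0\<close>
      continuous_on_subset[OF q] by auto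
  obtain a m where "p = (\<lambda>u. \<Sum>i\<le>m::nat. a i * u ^ i)"
    using p(1) by (auto simp: real_polynomial_function_iff_sum)
  moreover have "obeys_lln (\<lambda>x. \<Sum>i\<le>m. a i * sin (s * x + d) ^ i)"
    using sin_power_wave_lln[OF waves, of s d _ 0 0]
    by (intro obeys_lln_sum obeys_lln_scale) simp
  ultimately show "\<exists>h. obeys_lln h \<and> (\<forall>x. \<bar>q (sin (s * x + d)) - h x\<bar> < e)"
    using p(2) by (intro exI[of _ "\<lambda>x. p (sin (s * x + d))"]) auto
qed

text \<open>
  For fixed \<open>x\<close> the argument of the sine eventually lies between \<open>- \<pi>\<close> and \<open>\<pi>\<close>, where the sine has the sign of \<open>x - a\<close>,
  and a ramp of slope \<open>k\<^sup>2\<close> is steep enough to beat its decay, which is of order \<open>1 / k\<close>.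
\<close>
lemma tendsto_steep_sine_ramp:
  fixes x a :: real
  shows "(\<lambda>k. max 0 (min 1 (1 - (real k)\<^sup>2 * sin ((x - a) / real k)))) \<longlonglongrightarrow> indicator {..a} x"
proof (cases "x \<le> a")
  case True
  have "(\<lambda>k. (x - a) / real k) \<longlonglongrightarrow> 0" by (rule lim_const_over_n)
  then have "eventually (\<lambda>k. (x - a) / real k > - pi) sequentially"
    using order_tendstoD(1)[of _ 0 sequentially "- pi"] by auto
  then have "eventually (\<lambda>k. max 0 (min 1 (1 - (real k)\<^sup>2 * sin ((x - a) / real k))) = 1) sequentially"
  proof eventually_elim
    case (elim k)
    have "(x - a) / real k \<le> 0" using True by (simp add: divide_le_0_iff)
    then have "0 \<le> sin (- ((x - a) / real k))"
      using elim by (intro sin_ge_zero) linarith+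
    then have "sin ((x - a) / real k) \<le> 0" unfolding sin_minus by simp
    then have "(real k)\<^sup>2 * sin ((x - a) / real k) \<le> 0" by (simp add: mult_nonneg_nonpos)
    then show ?case by simp
  qed
  then show ?thesis using True by (auto intro: tendsto_eventually)
next
  case False
  define z where "z = x - a"
  have z: "z > 0" using False by (simp add: z_def)
  have "(\<lambda>k. z / real k) \<longlonglongrightarrow> 0" by (rule lim_const_over_n)
  moreover have "eventually (\<lambda>k. z / real k \<noteq> 0) sequentially"
    using eventually_gt_at_top[of 0] by eventually_elim (use z in auto)
  ultimately have "filterlim (\<lambda>k. z / real k) (at 0) sequentially"
    by (simp add: filterlim_at)
  from filterlim_compose[OF sinc_at_0 this]
  have "eventually (\<lambda>k. sin (z / real k) / (z / real k) > 1 / 2) sequentially"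
    by (rule order_tendstoD) simp
  moreover have "eventually (\<lambda>k. real k \<ge> 2 / z) sequentially"
    by (metis eventually_sequentiallyI nat_ceiling_le_eq)
  ultimately have "eventually (\<lambda>k. max 0 (min 1 (1 - (real k)\<^sup>2 * sin ((x - a) / real k))) = 0) sequentially"
    using eventually_gt_at_top[of 0]
  proof eventually_elim
    case (elim k)
    then have "sin (z / real k) \<ge> 1 / 2 * (z / real k)"
      using z by (simp add: field_simps)
    then have "(real k)\<^sup>2 * sin (z / real k) \<ge> (real k)\<^sup>2 * (1 / 2 * (z / real k))"
      by (intro mult_left_mono) auto
    also have "(real k)\<^sup>2 * (1 / 2 * (z / real k)) = real k * z / 2"
      using elim by (simp add: power2_eq_square)
    also have "real k * z / 2 \<ge> 1" using elim z by (simp add: field_simps)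
    finally show ?case by (simp add: z_def)
  qed
  then show ?thesis using False by (auto intro: tendsto_eventually)
qed

text \<open>
  Continuous functions of slower and slower sine waves converge boundedly to the indicator of a half-line.
  This takes the place of a Fourier inversion.
\<close>
lemma half_line_lln:
  assumes waves: "\<And>\<theta> c. obeys_lln (\<lambda>x. cos (\<theta> * x + c))"
  shows "obeys_lln (indicator {..a})"
proof (rule obeys_lln_dominated[OF _ tendsto_steep_sine_ramp, where w = "\<lambda>_. 1"])
  show "obeys_lln (\<lambda>x. max 0 (min 1 (1 - (real k)\<^sup>2 * sin ((x - a) / real k))))" for k
    using continuous_of_sin_lln[OF waves, of "\<lambda>u. max 0 (min 1 (1 - (real k)\<^sup>2 * u))" "1 / real k" "- a / real k"]
    by (simp add: diff_divide_distrib continuous_intros)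
qed auto

lemma integral_sample_error_square:
  assumes g: "g \<in> borel_measurable borel" and B: "\<And>x. \<bar>g x\<bar> \<le> B" and n: "n > 0"
  shows "(\<integral>\<omega>. (sample_error n g \<omega>)\<^sup>2 \<partial>M) =
    (\<Sum>i=1..n. \<Sum>j=1..n. (\<integral>\<omega>. g (X i \<omega>) * g (X j \<omega>) \<partial>M) - (\<integral>x. g x \<partial>\<gamma>)\<^sup>2) / (real n)\<^sup>2"
proof -
  let ?m = "\<integral>x. g x \<partial>\<gamma>"
  have gi: "integrable \<gamma> g"
    using g B by (intro law.integrable_const_bound[of _ B]) (auto simp: measurable_law)
  have gX: "(\<lambda>\<omega>. g (X k \<omega>)) \<in> borel_measurable M" if "k \<ge> 1" for k
    using g measurable_X[OF that] by measurable
  have int: "integrable M (\<lambda>\<omega>. g (X i \<omega>) * g (X j \<omega>))" if "i \<ge> 1" "j \<ge> 1" for i j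
  proof (rule integrable_const_bound[of _ "B * B"])
    show "AE \<omega> in M. norm (g (X i \<omega>) * g (X j \<omega>)) \<le> B * B"
      using B by (intro AE_I2) (simp add: abs_mult, intro mult_mono, auto intro: order_trans[OF abs_ge_zero])
  qed (use gX that in auto)
  have "sample_error n g \<omega> = (\<Sum>i=1..n. (g (X i \<omega>) - ?m)) / n" for \<omega>
    using n by (simp add: sample_error_def sum_subtractf diff_divide_distrib)
  then have "(sample_error n g \<omega>)\<^sup>2 = (\<Sum>i=1..n. \<Sum>j=1..n. (g (X i \<omega>) - ?m) * (g (X j \<omega>) - ?m)) / (real n)\<^sup>2" for \<omega>
    by (simp add: power_divide power2_eq_square sum_product)
  then have "(\<integral>\<omega>. (sample_error n g \<omega>)\<^sup>2 \<partial>M)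
      = (\<integral>\<omega>. (\<Sum>i=1..n. \<Sum>j=1..n. (g (X i \<omega>) - ?m) * (g (X j \<omega>) - ?m)) \<partial>M) / (real n)\<^sup>2"
    by simp
  also have "(\<integral>\<omega>. (\<Sum>i=1..n. \<Sum>j=1..n. (g (X i \<omega>) - ?m) * (g (X j \<omega>) - ?m)) \<partial>M)
      = (\<Sum>i=1..n. \<Sum>j=1..n. (\<integral>\<omega>. g (X i \<omega>) * g (X j \<omega>) \<partial>M) - ?m\<^sup>2)"
  proof -
    have product: "has_bochner_integral M (\<lambda>\<omega>. (g (X i \<omega>) - ?m) * (g (X j \<omega>) - ?m))
        ((\<integral>\<omega>. g (X i \<omega>) * g (X j \<omega>) \<partial>M) - ?m\<^sup>2)" if "i \<ge> 1" "j \<ge> 1" for i j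
    proof -
      have "has_bochner_integral M (\<lambda>\<omega>. g (X i \<omega>) * g (X j \<omega>) - ?m * g (X i \<omega>) - ?m * g (X j \<omega>) + ?m\<^sup>2)
        ((\<integral>\<omega>. g (X i \<omega>) * g (X j \<omega>) \<partial>M) - ?m * ?m - ?m * ?m + ?m\<^sup>2)"
        using int[OF that] integrable_comp[OF gi that(1)] integrable_comp[OF gi that(2)]
          integral_comp[OF g that(1)] integral_comp[OF g that(2)]
        by (simp add: has_bochner_integral_iff prob_space)
      then show ?thesis by (simp add: algebra_simps power2_eq_square)
    qed
    have "has_bochner_integral M (\<lambda>\<omega>. \<Sum>i=1..n. \<Sum>j=1..n. (g (X i \<omega>) - ?m) * (g (X j \<omega>) - ?m))
       (\<Sum>i=1..n. \<Sum>j=1..n. (\<integral>\<omega>. g (X i \<omega>) * g (X j \<omega>) \<partial>M) - ?m\<^sup>2)"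
      by (intro has_bochner_integral_sum product) auto
    then show ?thesis by (rule has_bochner_integral_integral_eq)
  qed
  finally show ?thesis .
qed

text \<open>
  For bounded \<open>g\<close> the \<open>L\<^sup>1\<close> and \<open>L\<^sup>2\<close> errors tend to zero together; the second is computable from the
  covariances.
\<close>
lemma obeys_lln_iff_mean_square:
  assumes g: "g \<in> borel_measurable borel" and B: "\<And>x. \<bar>g x\<bar> \<le> B"
  shows "obeys_lln g \<longleftrightarrow> (\<lambda>n. \<integral>\<omega>. (sample_error n g \<omega>)\<^sup>2 \<partial>M) \<longlonglongrightarrow> 0"
proof -
  have gi: "integrable \<gamma> g"
    using g B by (intro law.integrable_const_bound[of _ B]) (auto simp: measurable_law)
  have B0: "B \<ge> 0" using B[of 0] by linarith
  have bound: "\<bar>sample_error n g \<omega>\<bar> \<le> 2 * B" for n \<omega>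
  proof -
    have "\<bar>\<Sum>i=1..n. g (X i \<omega>)\<bar> \<le> (\<Sum>i=1..n. B)"
      by (rule order_trans[OF sum_abs sum_mono]) (rule B)
    then have "\<bar>(\<Sum>i=1..n. g (X i \<omega>)) / n\<bar> \<le> B"
      using B0 by (cases "n = 0") (auto simp: field_simps)
    moreover have "\<bar>\<integral>x. g x \<partial>\<gamma>\<bar> \<le> B"
    proof -
      have "(\<integral>x. \<bar>g x\<bar> \<partial>\<gamma>) \<le> (\<integral>x. B \<partial>\<gamma>)" using gi B by (intro integral_mono) auto
      then show ?thesis using order_trans[OF integral_abs_bound[of \<gamma> g]] law.prob_space by simp
    qed
    ultimately show ?thesis unfolding sample_error_def by linarith
  qed
  have int1: "integrable M (\<lambda>\<omega>. \<bar>sample_error n g \<omega>\<bar>)" for n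
    using integrable_sample_error[OF gi] by simp
  have int2: "integrable M (\<lambda>\<omega>. (sample_error n g \<omega>)\<^sup>2)" for n
  proof (rule integrable_const_bound[of _ "(2 * B)\<^sup>2"])
    have "(sample_error n g \<omega>)\<^sup>2 \<le> (2 * B)\<^sup>2" for \<omega>
      using bound[of n \<omega>] B0 abs_le_square_iff[of "sample_error n g \<omega>" "2 * B"] by simp
    then show "AE \<omega> in M. norm ((sample_error n g \<omega>)\<^sup>2) \<le> (2 * B)\<^sup>2" by simp
  qed (use integrable_sample_error[OF gi, of n] in auto)
  show ?thesis
  proof
    assume "obeys_lln g"
    then have "(\<lambda>n. \<integral>\<omega>. \<bar>sample_error n g \<omega>\<bar> \<partial>M) \<longlonglongrightarrow> 0" by (simp add: obeys_lln_def)
    from tendsto_mult_left[OF this, of "2 * B"]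
    have lim: "(\<lambda>n. 2 * B * (\<integral>\<omega>. \<bar>sample_error n g \<omega>\<bar> \<partial>M)) \<longlonglongrightarrow> 0" by simp
    have "norm (\<integral>\<omega>. (sample_error n g \<omega>)\<^sup>2 \<partial>M) \<le> 2 * B * (\<integral>\<omega>. \<bar>sample_error n g \<omega>\<bar> \<partial>M)" for n
    proof -
      have "(sample_error n g \<omega>)\<^sup>2 \<le> 2 * B * \<bar>sample_error n g \<omega>\<bar>" for \<omega>
        using mult_right_mono[OF bound[of n \<omega>], of "\<bar>sample_error n g \<omega>\<bar>"]
        by (simp add: power2_eq_square flip: abs_mult)
      then have "(\<integral>\<omega>. (sample_error n g \<omega>)\<^sup>2 \<partial>M) \<le> (\<integral>\<omega>. 2 * B * \<bar>sample_error n g \<omega>\<bar> \<partial>M)"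
        using int1 int2 by (intro integral_mono) auto
      then show ?thesis by simp
    qed
    then show "(\<lambda>n. \<integral>\<omega>. (sample_error n g \<omega>)\<^sup>2 \<partial>M) \<longlonglongrightarrow> 0"
      by (intro Lim_null_comparison[OF always_eventually lim] allI)
  next
    assume "(\<lambda>n. \<integral>\<omega>. (sample_error n g \<omega>)\<^sup>2 \<partial>M) \<longlonglongrightarrow> 0"
    from tendsto_real_sqrt[OF this]
    have lim: "(\<lambda>n. sqrt (\<integral>\<omega>. (sample_error n g \<omega>)\<^sup>2 \<partial>M)) \<longlonglongrightarrow> 0" by simp
    have "norm (\<integral>\<omega>. \<bar>sample_error n g \<omega>\<bar> \<partial>M) \<le> sqrt (\<integral>\<omega>. (sample_error n g \<omega>)\<^sup>2 \<partial>M)" for n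
    proof -
      have "0 \<le> variance (\<lambda>\<omega>. \<bar>sample_error n g \<omega>\<bar>)" by simp
      also have "\<dots> = (\<integral>\<omega>. (sample_error n g \<omega>)\<^sup>2 \<partial>M) - (\<integral>\<omega>. \<bar>sample_error n g \<omega>\<bar> \<partial>M)\<^sup>2"
        using variance_eq[OF int1, of n] int2[of n] by simp
      finally show ?thesis by (simp add: real_le_rsqrt)
    qed
    then have "(\<lambda>n. \<integral>\<omega>. \<bar>sample_error n g \<omega>\<bar> \<partial>M) \<longlonglongrightarrow> 0"
      by (intro Lim_null_comparison[OF always_eventually lim] allI)
    then show "obeys_lln g" using gi by (simp add: obeys_lln_def)
  qed
qed

end

section \<open>Moments and cosine means of normal laws\<close>

text \<open>
  The affine image treats the degenerate case \<open>\<sigma> = 0\<close> on the same footing as the others, so the integrals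
  below reduce to the standard normal law without case distinction.
\<close>
lemma normal_distribution_eq_distr:
  assumes "\<sigma> \<ge> 0"
  shows "normal_distribution \<mu> \<sigma> = distr std_normal_distribution borel (\<lambda>x. \<mu> + \<sigma> * x)"
proof (cases "\<sigma> = 0")
  case True
  interpret real_distribution std_normal_distribution by (rule real_dist_normal_dist)
  show ?thesis
  proof (rule measure_eqI)
    fix A assume "A \<in> sets (normal_distribution \<mu> \<sigma>)"
    then show "emeasure (normal_distribution \<mu> \<sigma>) A
        = emeasure (distr std_normal_distribution borel (\<lambda>x. \<mu> + \<sigma> * x)) A"
      using True emeasure_space_1
      by (cases "\<mu> \<in> A") (auto simp: normal_distribution_def emeasure_distr)
  qed (auto simp: normal_distribution_def)
next
  case False
  interpret real_distribution std_normal_distribution by (rule real_dist_normal_dist)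
  have "distributed std_normal_distribution lborel (\<lambda>x. x) std_normal_density"
    unfolding distributed_def by (auto intro!: distr_id2)
  from normal_density_affine[OF this, of \<sigma> \<mu>]
  have "distributed std_normal_distribution lborel (\<lambda>x. \<mu> + \<sigma> * x) (normal_density \<mu> \<sigma>)"
    using False assms by simp
  then have "distr std_normal_distribution lborel (\<lambda>x. \<mu> + \<sigma> * x) = density lborel (normal_density \<mu> \<sigma>)"
    by (rule distributed_distr_eq_density)
  moreover have "distr std_normal_distribution lborel (\<lambda>x. \<mu> + \<sigma> * x)
      = distr std_normal_distribution borel (\<lambda>x. \<mu> + \<sigma> * x)"
    by (rule distr_cong) auto
  ultimately show ?thesis using False by (simp add: normal_distribution_def)
qed

lemma std_normal_moments:
  "has_bochner_integral std_normal_distribution (\<lambda>x. x) 0"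
  "has_bochner_integral std_normal_distribution (\<lambda>x. x\<^sup>2) 1"
  using integrable_std_normal_distribution_moment[of 1] integral_std_normal_distribution_moment_odd[of 1]
    std_normal_distribution_even_moments[of 1]
  by (simp_all add: has_bochner_integral_iff fact_numeral)

lemma
  assumes "\<sigma> \<ge> 0"
  shows normal_distribution_mean: "(\<integral>x. x \<partial>normal_distribution \<mu> \<sigma>) = \<mu>"
    and normal_distribution_second_moment: "(\<integral>x. x\<^sup>2 \<partial>normal_distribution \<mu> \<sigma>) = \<mu>\<^sup>2 + \<sigma>\<^sup>2"
    and normal_distribution_cos:
      "(\<integral>x. cos (x + c) \<partial>normal_distribution \<mu> \<sigma>) = cos (\<mu> + c) * exp (- (\<sigma>\<^sup>2 / 2))"
proof -
  interpret real_distribution std_normal_distribution by (rule real_dist_normal_dist)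
  note [simp] = normal_distribution_eq_distr[OF assms] integral_distr
  note moments = std_normal_moments
  have "has_bochner_integral std_normal_distribution (\<lambda>x. \<mu> + \<sigma> * x) (measure std_normal_distribution UNIV * \<mu> + \<sigma> * 0)"
    using moments by (intro has_bochner_integral_add has_bochner_integral_mult_right)
      (auto simp: has_bochner_integral_iff)
  then show "(\<integral>x. x \<partial>normal_distribution \<mu> \<sigma>) = \<mu>"
    using prob_space by (simp add: has_bochner_integral_integral_eq)
  have "has_bochner_integral std_normal_distribution (\<lambda>x. \<mu>\<^sup>2 + 2 * \<mu> * \<sigma> * x + \<sigma>\<^sup>2 * x\<^sup>2)
     (measure std_normal_distribution UNIV * \<mu>\<^sup>2 + 2 * \<mu> * \<sigma> * 0 + \<sigma>\<^sup>2 * 1)"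
    using moments by (intro has_bochner_integral_add has_bochner_integral_mult_right)
      (auto simp: has_bochner_integral_iff)
  moreover have "(\<lambda>x. \<mu>\<^sup>2 + 2 * \<mu> * \<sigma> * x + \<sigma>\<^sup>2 * x\<^sup>2) = (\<lambda>x. (\<mu> + \<sigma> * x)\<^sup>2)"
    by (simp add: power2_eq_square algebra_simps)
  ultimately show "(\<integral>x. x\<^sup>2 \<partial>normal_distribution \<mu> \<sigma>) = \<mu>\<^sup>2 + \<sigma>\<^sup>2"
    using prob_space by (simp add: has_bochner_integral_integral_eq)
  have "integral\<^sup>L std_normal_distribution (\<lambda>x. iexp (\<sigma> * x)) = complex_of_real (exp (- (\<sigma>\<^sup>2) / 2))"
    using char_std_normal_distribution by (simp add: char_def fun_eq_iff)
  then have Re: "(\<integral>x. Re (iexp (\<sigma> * x)) \<partial>std_normal_distribution) = exp (- (\<sigma>\<^sup>2) / 2)"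
    and Im: "(\<integral>x. Im (iexp (\<sigma> * x)) \<partial>std_normal_distribution) = 0"
    using integral_Re[OF integrable_iexp, of "\<lambda>x. \<sigma> * x"] integral_Im[OF integrable_iexp, of "\<lambda>x. \<sigma> * x"]
    by (simp_all del: integral_Re integral_Im)
  have "has_bochner_integral std_normal_distribution (\<lambda>x. cos (\<sigma> * x)) (exp (- (\<sigma>\<^sup>2) / 2))"
    "has_bochner_integral std_normal_distribution (\<lambda>x. sin (\<sigma> * x)) 0"
    using Re Im by (auto simp: has_bochner_integral_iff Re_exp Im_exp intro!: integrable_const_bound[of _ 1])
  then have "has_bochner_integral std_normal_distribution
      (\<lambda>x. cos (\<mu> + c) * cos (\<sigma> * x) - sin (\<mu> + c) * sin (\<sigma> * x))
      (cos (\<mu> + c) * exp (- (\<sigma>\<^sup>2) / 2) - sin (\<mu> + c) * 0)"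
    by (intro has_bochner_integral_diff has_bochner_integral_mult_right)
  moreover have "(\<lambda>x. cos (\<mu> + c) * cos (\<sigma> * x) - sin (\<mu> + c) * sin (\<sigma> * x)) = (\<lambda>x. cos (\<mu> + \<sigma> * x + c))"
    by (simp add: cos_add[symmetric] algebra_simps)
  ultimately show "(\<integral>x. cos (x + c) \<partial>normal_distribution \<mu> \<sigma>) = cos (\<mu> + c) * exp (- (\<sigma>\<^sup>2 / 2))"
    by (simp add: has_bochner_integral_integral_eq)
qed

section \<open>Covariances of sinusoids of a Gaussian process\<close>

lemma abs_exp_minus_one_le: "\<bar>exp v - 1\<bar> \<le> \<bar>v\<bar> * exp \<bar>v\<bar>" for v :: real
proof (cases "v \<ge> 0")
  case True
  have "1 - v \<le> exp (- v)" using exp_ge_add_one_self[of "-v"] by simp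
  then have "(1 - v) * exp v \<le> exp (- v) * exp v" by (intro mult_right_mono) auto
  then show ?thesis using True by (simp add: algebra_simps flip: exp_add)
next
  case False
  have "1 - exp v \<le> \<bar>v\<bar> * 1" using exp_ge_add_one_self[of v] False by linarith
  also have "\<dots> \<le> \<bar>v\<bar> * exp \<bar>v\<bar>" by (intro mult_left_mono) auto
  finally show ?thesis using False by simp
qed

lemma cosh_ge_quadratic: "1 + x\<^sup>2 / 2 \<le> cosh x" for x :: real
proof -
  have "(x / 2)\<^sup>2 \<le> (sinh (x / 2))\<^sup>2"
    using real_le_abs_sinh[of "x / 2"]
    by (simp add: abs_le_square_iff[symmetric] sinh_field_def exp_minus)
  moreover have "cosh x = 1 + 2 * (sinh (x / 2))\<^sup>2"
    using cosh_double[of "x / 2"] by (simp add: cosh_square_eq)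
  ultimately show ?thesis by (simp add: power_divide)
qed

locale standardized_gaussian = identically_distributed M X std_normal_distribution
  for M :: "'a measure" and X :: "nat \<Rightarrow> 'a \<Rightarrow> real" +
  assumes gaussian: "gaussian_process M X"
begin

abbreviation \<rho> :: "nat \<Rightarrow> nat \<Rightarrow> real" where
  "\<rho> i j \<equiv> covariance M (X i) (X j)"

lemma moments_X:
  assumes "k \<ge> 1"
  shows "has_bochner_integral M (X k) 0" "has_bochner_integral M (\<lambda>\<omega>. (X k \<omega>)\<^sup>2) 1"
proof -
  have transfer: "has_bochner_integral M (\<lambda>\<omega>. f (X k \<omega>)) I"
    if "has_bochner_integral std_normal_distribution f I" "f \<in> borel_measurable borel" for f :: "real \<Rightarrow> real" and I
    using that(1) integrable_distr_eq[OF measurable_X[OF assms] that(2)]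
      integral_distr[OF measurable_X[OF assms] that(2)] distr_X[OF assms]
    by (simp add: has_bochner_integral_iff)
  show "has_bochner_integral M (X k) 0"
    using transfer[OF std_normal_moments(1)] by simp
  show "has_bochner_integral M (\<lambda>\<omega>. (X k \<omega>)\<^sup>2) 1"
    using transfer[OF std_normal_moments(2)] by simp
qed

lemma mixed_moment:
  assumes "i \<ge> 1" "j \<ge> 1"
  shows "has_bochner_integral M (\<lambda>\<omega>. X i \<omega> * X j \<omega>) (\<rho> i j)"
proof -
  have "integrable M (\<lambda>\<omega>. X i \<omega> * X j \<omega>)"
  proof (rule Bochner_Integration.integrable_bound[of _ "\<lambda>\<omega>. (X i \<omega>)\<^sup>2 + (X j \<omega>)\<^sup>2"])
    show "integrable M (\<lambda>\<omega>. (X i \<omega>)\<^sup>2 + (X j \<omega>)\<^sup>2)"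
      using moments_X[OF assms(1)] moments_X[OF assms(2)] by (auto simp: has_bochner_integral_iff)
    show "(\<lambda>\<omega>. X i \<omega> * X j \<omega>) \<in> borel_measurable M"
      using measurable_X assms by simp
    show "AE \<omega> in M. norm (X i \<omega> * X j \<omega>) \<le> norm ((X i \<omega>)\<^sup>2 + (X j \<omega>)\<^sup>2)"
    proof (rule AE_I2)
      fix \<omega>
      have "2 * \<bar>X i \<omega>\<bar> * \<bar>X j \<omega>\<bar> \<le> \<bar>X i \<omega>\<bar>\<^sup>2 + \<bar>X j \<omega>\<bar>\<^sup>2" by (rule sum_squares_bound)
      moreover have "0 \<le> \<bar>X i \<omega>\<bar> * \<bar>X j \<omega>\<bar>" by simp
      ultimately show "norm (X i \<omega> * X j \<omega>) \<le> norm ((X i \<omega>)\<^sup>2 + (X j \<omega>)\<^sup>2)"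
        unfolding real_norm_def abs_mult power2_abs by linarith
    qed
  qed
  then show ?thesis
    using moments_X(1)[OF assms(1)] moments_X(1)[OF assms(2)]
    by (simp add: covariance_def has_bochner_integral_iff)
qed

lemma covariance_self: "k \<ge> 1 \<Longrightarrow> \<rho> k k = 1"
  using has_bochner_integral_eq[OF mixed_moment[of k k]] moments_X(2)[of k]
  by (simp add: power2_eq_square)

lemma covariance_commute: "\<rho> i j = \<rho> j i"
  by (simp add: covariance_def mult.commute)

lemma second_moment_combination:
  assumes "i \<ge> 1" "j \<ge> 1"
  shows "(\<integral>\<omega>. (a * X i \<omega> + b * X j \<omega>)\<^sup>2 \<partial>M) = a\<^sup>2 + b\<^sup>2 + 2 * a * b * \<rho> i j"
proof -
  have "has_bochner_integral M
      (\<lambda>\<omega>. a\<^sup>2 * (X i \<omega>)\<^sup>2 + b\<^sup>2 * (X j \<omega>)\<^sup>2 + 2 * a * b * (X i \<omega> * X j \<omega>))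
      (a\<^sup>2 * 1 + b\<^sup>2 * 1 + 2 * a * b * \<rho> i j)"
    by (intro has_bochner_integral_add has_bochner_integral_mult_right mixed_moment moments_X assms)
  moreover have "(\<lambda>\<omega>. a\<^sup>2 * (X i \<omega>)\<^sup>2 + b\<^sup>2 * (X j \<omega>)\<^sup>2 + 2 * a * b * (X i \<omega> * X j \<omega>))
      = (\<lambda>\<omega>. (a * X i \<omega> + b * X j \<omega>)\<^sup>2)"
    by (simp add: power2_eq_square algebra_simps)
  ultimately show ?thesis by (simp add: has_bochner_integral_integral_eq)
qed

lemma abs_covariance_le_1:
  assumes "i \<ge> 1" "j \<ge> 1" shows "\<bar>\<rho> i j\<bar> \<le> 1"
proof -
  have "0 \<le> 1 + b\<^sup>2 + 2 * b * \<rho> i j" for b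
    using second_moment_combination[OF assms, of 1 b]
      Bochner_Integration.integral_nonneg[of M "\<lambda>\<omega>. (1 * X i \<omega> + b * X j \<omega>)\<^sup>2"] by simp
  from this[of 1] this[of "-1"] show ?thesis by (simp add: abs_le_iff)
qed

lemma combination_normal:
  assumes "i \<ge> 1" "j \<ge> 1"
  shows "\<exists>\<mu> \<sigma>. \<sigma> \<ge> 0 \<and> distr M borel (\<lambda>\<omega>. a * X i \<omega> + b * X j \<omega>) = normal_distribution \<mu> \<sigma>"
proof -
  have normal: "\<exists>\<mu> \<sigma>. \<sigma> \<ge> 0 \<and> distr M borel (\<lambda>\<omega>. \<Sum>k\<in>J. c k * X k \<omega>) = normal_distribution \<mu> \<sigma>"
    if J: "finite J" "J \<noteq> {}" "J \<subseteq> {1..}" for J c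
  proof -
    let ?P = "Pi\<^sub>M J (\<lambda>_. borel) :: (nat \<Rightarrow> real) measure"
    have "distr (distr M ?P (\<lambda>\<omega>. \<lambda>k\<in>J. X k \<omega>)) borel (\<lambda>x. \<Sum>k\<in>J. c k * x k)
        = distr M borel ((\<lambda>x. \<Sum>k\<in>J. c k * x k) \<circ> (\<lambda>\<omega>. \<lambda>k\<in>J. X k \<omega>))"
    proof (rule distr_distr)
      show "(\<lambda>\<omega>. \<lambda>k\<in>J. X k \<omega>) \<in> M \<rightarrow>\<^sub>M ?P"
        using J measurable_X by (intro measurable_restrict) auto
      show "(\<lambda>x. \<Sum>k\<in>J. c k * x k) \<in> borel_measurable ?P"
        by measurable
    qed
    also have "(\<lambda>x. \<Sum>k\<in>J. c k * x k) \<circ> (\<lambda>\<omega>. \<lambda>k\<in>J. X k \<omega>) = (\<lambda>\<omega>. \<Sum>k\<in>J. c k * X k \<omega>)"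
      by (auto simp: fun_eq_iff intro!: sum.cong)
    finally have *: "distr (distr M ?P (\<lambda>\<omega>. \<lambda>k\<in>J. X k \<omega>)) borel (\<lambda>x. \<Sum>k\<in>J. c k * x k)
      = distr M borel (\<lambda>\<omega>. \<Sum>k\<in>J. c k * X k \<omega>)" .
    have "multivariate_normal J (distr M ?P (\<lambda>\<omega>. \<lambda>k\<in>J. X k \<omega>))"
      using gaussian J unfolding gaussian_process_def by blast
    then show ?thesis
      unfolding multivariate_normal_def *[symmetric] by blast
  qed
  show ?thesis
  proof (cases "i = j")
    case True
    then show ?thesis using normal[of "{i}" "\<lambda>_. a + b"] assms by (simp add: algebra_simps)
  next
    case False
    then show ?thesis using normal[of "{i, j}" "\<lambda>k. if k = i then a else b"] assms by simp
  qed
qed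

text \<open>
  A linear combination of two members of the process is normal, hence determined by its mean zero and its
  variance. Only one-dimensional laws occur: no bivariate density is needed.
\<close>
lemma expectation_cos_combination:
  assumes ij: "i \<ge> 1" "j \<ge> 1"
  shows "(\<integral>\<omega>. cos (a * X i \<omega> + b * X j \<omega> + c) \<partial>M)
    = cos c * exp (- ((a\<^sup>2 + b\<^sup>2 + 2 * a * b * \<rho> i j) / 2))"
proof -
  obtain \<mu> \<sigma> where \<sigma>: "\<sigma> \<ge> 0"
    and law: "distr M borel (\<lambda>\<omega>. a * X i \<omega> + b * X j \<omega>) = normal_distribution \<mu> \<sigma>"
    using combination_normal[OF ij] by blast
  have transfer: "(\<integral>\<omega>. f (a * X i \<omega> + b * X j \<omega>) \<partial>M) = (\<integral>x. f x \<partial>normal_distribution \<mu> \<sigma>)"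
    if "f \<in> borel_measurable borel" for f :: "real \<Rightarrow> real"
    unfolding law[symmetric] by (rule integral_distr[symmetric]) (use measurable_X ij that in auto)
  have "has_bochner_integral M (\<lambda>\<omega>. a * X i \<omega> + b * X j \<omega>) (a * 0 + b * 0)"
    by (intro has_bochner_integral_add has_bochner_integral_mult_right moments_X ij)
  then have \<mu>: "\<mu> = 0"
    using transfer[of "\<lambda>x. x"] normal_distribution_mean[OF \<sigma>]
    by (simp add: has_bochner_integral_integral_eq)
  have "\<sigma>\<^sup>2 = a\<^sup>2 + b\<^sup>2 + 2 * a * b * \<rho> i j"
    using transfer[of "\<lambda>x. x\<^sup>2"] normal_distribution_second_moment[OF \<sigma>] \<mu>
      second_moment_combination[OF ij] by simp
  then show ?thesis
    using transfer[of "\<lambda>x. cos (x + c)"] normal_distribution_cos[OF \<sigma>] \<mu> by simp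
qed

lemma wave_mean: "(\<integral>x. cos (\<theta> * x + c) \<partial>std_normal_distribution) = cos c * exp (- (\<theta>\<^sup>2 / 2))"
  using expectation_cos_combination[of 1 1 \<theta> 0 c] integral_comp[of "\<lambda>x. cos (\<theta> * x + c)" 1] by simp

text \<open>
  A product of two cosines is half the sum of the cosines of sum and difference, and both of these
  are cosines of linear combinations of \<open>X i\<close> and \<open>X j\<close>.
\<close>
lemma wave_covariance:
  assumes ij: "i \<ge> 1" "j \<ge> 1"
  shows "(\<integral>\<omega>. cos (\<theta> * X i \<omega> + c) * cos (\<theta> * X j \<omega> + c) \<partial>M)
      - (\<integral>x. cos (\<theta> * x + c) \<partial>std_normal_distribution)\<^sup>2
    = exp (- \<theta>\<^sup>2) / 2 * (cos (2 * c) * (exp (- (\<theta>\<^sup>2 * \<rho> i j)) - 1) + (exp (\<theta>\<^sup>2 * \<rho> i j) - 1))"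
proof -
  have int: "integrable M (\<lambda>\<omega>. cos (a * X i \<omega> + b * X j \<omega> + c))" for a b c
    using measurable_X ij by (intro integrable_const_bound[of _ 1]) auto
  let ?E = "exp (- \<theta>\<^sup>2)" and ?v = "\<theta>\<^sup>2 * \<rho> i j"
  have product_formula: "cos (\<theta> * x + c) * cos (\<theta> * y + c) =
      (cos (\<theta> * x + \<theta> * y + 2 * c) + cos (\<theta> * x + (- \<theta>) * y + 0)) / 2" for x y
  proof -
    have phases: "\<theta> * x + \<theta> * y + 2 * c = (\<theta> * x + c) + (\<theta> * y + c)"
      "\<theta> * x + (- \<theta>) * y + 0 = (\<theta> * x + c) - (\<theta> * y + c)" by simp_all
    show ?thesis unfolding phases cos_times_cos by (simp only: add.commute)
  qed
  have "(\<integral>\<omega>. cos (\<theta> * X i \<omega> + c) * cos (\<theta> * X j \<omega> + c) \<partial>M)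
      = (\<integral>\<omega>. (cos (\<theta> * X i \<omega> + \<theta> * X j \<omega> + 2 * c) + cos (\<theta> * X i \<omega> + (- \<theta>) * X j \<omega> + 0)) / 2 \<partial>M)"
    by (simp only: product_formula)
  also have "\<dots> = ((\<integral>\<omega>. cos (\<theta> * X i \<omega> + \<theta> * X j \<omega> + 2 * c) \<partial>M)
      + (\<integral>\<omega>. cos (\<theta> * X i \<omega> + (- \<theta>) * X j \<omega> + 0) \<partial>M)) / 2"
    by (simp only: integral_divide_zero Bochner_Integration.integral_add[OF int int])
  also have "\<dots> = (cos (2 * c) * (?E * exp (- ?v)) + ?E * exp ?v) / 2"
  proof -
    have variances: "- ((\<theta>\<^sup>2 + \<theta>\<^sup>2 + 2 * \<theta> * \<theta> * \<rho> i j) / 2) = - \<theta>\<^sup>2 + - ?v"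
      "- ((\<theta>\<^sup>2 + (- \<theta>)\<^sup>2 + 2 * \<theta> * (- \<theta>) * \<rho> i j) / 2) = - \<theta>\<^sup>2 + ?v"
      by (simp_all add: power2_eq_square field_simps)
    show ?thesis
      unfolding expectation_cos_combination[OF ij] variances exp_add by simp
  qed
  finally have product: "(\<integral>\<omega>. cos (\<theta> * X i \<omega> + c) * cos (\<theta> * X j \<omega> + c) \<partial>M)
      = (cos (2 * c) * (?E * exp (- ?v)) + ?E * exp ?v) / 2" .
  have "(exp (- (\<theta>\<^sup>2 / 2)))\<^sup>2 = ?E"
    unfolding power2_eq_square[of "exp _"] mult_exp_exp by simp
  then have square: "(\<integral>x. cos (\<theta> * x + c) \<partial>std_normal_distribution)\<^sup>2 = (1 + cos (2 * c)) / 2 * ?E"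
    unfolding wave_mean by (simp add: power_mult_distrib cos_double_cos)
  show ?thesis unfolding product square by (simp add: algebra_simps add_divide_distrib diff_divide_distrib)
qed

lemma wave_covariance_le:
  assumes ij: "i \<ge> 1" "j \<ge> 1"
  shows "\<bar>(\<integral>\<omega>. cos (\<theta> * X i \<omega> + c) * cos (\<theta> * X j \<omega> + c) \<partial>M)
      - (\<integral>x. cos (\<theta> * x + c) \<partial>std_normal_distribution)\<^sup>2\<bar> \<le> \<theta>\<^sup>2 * \<bar>\<rho> i j\<bar>"
proof -
  define v where "v = \<theta>\<^sup>2 * \<rho> i j"
  have v: "\<bar>v\<bar> = \<theta>\<^sup>2 * \<bar>\<rho> i j\<bar>" by (simp add: v_def abs_mult)
  have "\<bar>v\<bar> \<le> \<theta>\<^sup>2" unfolding v using abs_covariance_le_1[OF ij] by (simp add: mult_left_le)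
  then have "\<bar>v\<bar> * exp \<bar>v\<bar> \<le> \<bar>v\<bar> * exp (\<theta>\<^sup>2)" by (intro mult_left_mono) auto
  then have e: "\<bar>exp v - 1\<bar> \<le> \<bar>v\<bar> * exp (\<theta>\<^sup>2)" "\<bar>exp (- v) - 1\<bar> \<le> \<bar>v\<bar> * exp (\<theta>\<^sup>2)"
    using abs_exp_minus_one_le[of v] abs_exp_minus_one_le[of "- v"] by simp_all
  have "\<bar>cos (2 * c) * (exp (- v) - 1)\<bar> \<le> 1 * \<bar>exp (- v) - 1\<bar>"
    unfolding abs_mult by (intro mult_right_mono) auto
  then have "\<bar>cos (2 * c) * (exp (- v) - 1) + (exp v - 1)\<bar> \<le> 2 * (\<bar>v\<bar> * exp (\<theta>\<^sup>2))"
    using e abs_triangle_ineq[of "cos (2 * c) * (exp (- v) - 1)" "exp v - 1"]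
    by (simp only: mult_1 mult_2)
  then have "exp (- \<theta>\<^sup>2) / 2 * \<bar>cos (2 * c) * (exp (- v) - 1) + (exp v - 1)\<bar>
      \<le> exp (- \<theta>\<^sup>2) / 2 * (2 * (\<bar>v\<bar> * exp (\<theta>\<^sup>2)))"
    by (intro mult_left_mono) auto
  also have "\<dots> = \<bar>v\<bar>" by (simp add: exp_minus)
  finally show ?thesis
    unfolding wave_covariance[OF ij] v_def[symmetric] v[symmetric] by (simp add: abs_mult)
qed

text \<open>
  For the plain cosine the covariance is \<open>exp (-1) * (cosh (\<rho> i j) - 1)\<close>: even in the correlation, so that
  positive and negative correlations cannot cancel when they are averaged.
\<close>
lemma cos_covariance_ge:
  assumes ij: "i \<ge> 1" "j \<ge> 1"
  shows "(\<rho> i j)\<^sup>2 \<le> 2 * exp 1 * ((\<integral>\<omega>. cos (X i \<omega>) * cos (X j \<omega>) \<partial>M)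
      - (\<integral>x. cos x \<partial>std_normal_distribution)\<^sup>2)"
proof -
  have "(\<integral>\<omega>. cos (X i \<omega>) * cos (X j \<omega>) \<partial>M) - (\<integral>x. cos x \<partial>std_normal_distribution)\<^sup>2
      = exp (- 1) * (cosh (\<rho> i j) - 1)"
    using wave_covariance[OF ij, of 1 0] by (simp add: cosh_field_def field_simps)
  then have "2 * exp 1 * ((\<integral>\<omega>. cos (X i \<omega>) * cos (X j \<omega>) \<partial>M)
      - (\<integral>x. cos x \<partial>std_normal_distribution)\<^sup>2) = 2 * (cosh (\<rho> i j) - 1)"
    by (simp add: exp_minus field_simps)
  then show ?thesis using cosh_ge_quadratic[of "\<rho> i j"] by simp
qed

section \<open>Weak dependence and the law of large numbers for sinusoids\<close>

text \<open>
  The average over all ordered pairs, the diagonal included. The diagonal contributes \<open>1 / n\<close>, so this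
  tends to zero exactly when \<open>\<Delta>(n) / n\<^sup>2\<close> does.
\<close>
definition mean_abs_covariance :: "nat \<Rightarrow> real" where
  "mean_abs_covariance n = (\<Sum>i=1..n. \<Sum>j=1..n. \<bar>\<rho> i j\<bar>) / (real n)\<^sup>2"

lemma dependence_measure_eq:
  "(\<Sum>i=1..n. \<Sum>j=1..n. \<bar>\<rho> i j\<bar>) = real n + dependence_measure M X n"
proof -
  let ?I = "{1..n}" and ?f = "\<lambda>(i, j). \<bar>\<rho> i j\<bar>"
  let ?L = "{(i, j). 1 \<le> i \<and> i < j \<and> j \<le> n}" and ?D = "(\<lambda>i. (i, i)) ` ?I"
  have pairs: "?I \<times> ?I = ?D \<union> (?L \<union> prod.swap ` ?L)"
    by (force simp: image_iff)
  have finL: "finite ?L" by (rule finite_subset[of _ "?I \<times> ?I"]) auto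
  have "(\<Sum>i=1..n. \<Sum>j=1..n. \<bar>\<rho> i j\<bar>) = sum ?f (?I \<times> ?I)"
    by (simp add: sum.cartesian_product)
  also have "\<dots> = sum ?f ?D + (sum ?f ?L + sum ?f (prod.swap ` ?L))"
    unfolding pairs using finL
    by (subst sum.union_disjoint, auto)+
  also have "sum ?f ?D = real n"
    by (subst sum.reindex) (auto simp: inj_on_def covariance_self)
  also have "sum ?f (prod.swap ` ?L) = sum ?f ?L"
    by (subst sum.reindex) (auto intro!: sum.cong simp: covariance_commute)
  finally show ?thesis by (simp add: dependence_measure_def)
qed

lemma weakly_dependent_iff: "weakly_dependent_normal M X \<longleftrightarrow> mean_abs_covariance \<longlonglongrightarrow> 0"
proof -
  have "standardized_gaussian_process M X"
    using gaussian distr_X by (simp add: standardized_gaussian_process_def)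
  then have "weakly_dependent_normal M X
      \<longleftrightarrow> (\<lambda>n. dependence_measure M X n / (real n)\<^sup>2) \<longlonglongrightarrow> 0"
    unfolding weakly_dependent_normal_def
    by (auto intro!: smalloI_tendsto dest: smalloD_tendsto simp: eventually_gt_at_top
        intro: eventually_mono[OF eventually_gt_at_top[of 0]])
  also have "\<dots> \<longleftrightarrow> (\<lambda>n. dependence_measure M X n / (real n)\<^sup>2 + 1 / real n) \<longlonglongrightarrow> 0"
    using tendsto_add[OF _ lim_1_over_n, of "\<lambda>n. dependence_measure M X n / (real n)\<^sup>2" 0]
      tendsto_diff[OF _ lim_1_over_n, of "\<lambda>n. dependence_measure M X n / (real n)\<^sup>2 + 1 / real n" 0]
    by auto
  also have "(\<lambda>n. dependence_measure M X n / (real n)\<^sup>2 + 1 / real n) = mean_abs_covariance"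
    unfolding mean_abs_covariance_def[abs_def] dependence_measure_eq
    by (auto simp: fun_eq_iff power2_eq_square add_divide_distrib)
  finally show ?thesis .
qed

text \<open>
  The mean square error is the average of the covariances, each of which is at most \<open>\<theta>\<^sup>2 * \<bar>\<rho> i j\<bar>\<close>.
\<close>
lemma weakly_dependent_imp_waves:
  assumes "mean_abs_covariance \<longlonglongrightarrow> 0"
  shows "obeys_lln (\<lambda>x. cos (\<theta> * x + c))"
proof -
  let ?g = "\<lambda>x. cos (\<theta> * x + c)"
  have "(\<lambda>n. \<integral>\<omega>. (sample_error n ?g \<omega>)\<^sup>2 \<partial>M) \<longlonglongrightarrow> 0"
  proof (rule Lim_null_comparison)
    show "(\<lambda>n. \<theta>\<^sup>2 * mean_abs_covariance n) \<longlonglongrightarrow> 0"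
      using tendsto_mult_left[OF assms, of "\<theta>\<^sup>2"] by simp
    show "eventually (\<lambda>n. norm (\<integral>\<omega>. (sample_error n ?g \<omega>)\<^sup>2 \<partial>M) \<le> \<theta>\<^sup>2 * mean_abs_covariance n) sequentially"
      using eventually_gt_at_top[of 0]
    proof eventually_elim
      case (elim n)
      let ?c = "\<lambda>i j. (\<integral>\<omega>. ?g (X i \<omega>) * ?g (X j \<omega>) \<partial>M) - (\<integral>x. ?g x \<partial>std_normal_distribution)\<^sup>2"
      have "(\<integral>\<omega>. (sample_error n ?g \<omega>)\<^sup>2 \<partial>M) = (\<Sum>i=1..n. \<Sum>j=1..n. ?c i j) / (real n)\<^sup>2"
        using elim by (subst integral_sample_error_square[where B = 1]) auto
      moreover have "(\<Sum>i=1..n. \<Sum>j=1..n. ?c i j) \<le> (\<Sum>i=1..n. \<Sum>j=1..n. \<theta>\<^sup>2 * \<bar>\<rho> i j\<bar>)"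
        by (intro sum_mono order_trans[OF abs_ge_self wave_covariance_le]) auto
      ultimately have "(\<integral>\<omega>. (sample_error n ?g \<omega>)\<^sup>2 \<partial>M) \<le> (\<Sum>i=1..n. \<Sum>j=1..n. \<theta>\<^sup>2 * \<bar>\<rho> i j\<bar>) / (real n)\<^sup>2"
        by (simp only: divide_right_mono zero_le_power2)
      then show ?case
        by (simp add: mean_abs_covariance_def sum_distrib_left[symmetric])
    qed
  qed
  then show ?thesis by (subst obeys_lln_iff_mean_square[where B = 1]) auto
qed

text \<open>
  Up to the factor \<open>2 * exp 1\<close>, the mean square error for the cosine dominates the average of the squared
  correlations, and by Cauchy--Schwarz this dominates the square of the average of their absolute values.
\<close>
lemma cos_lln_imp_weakly_dependent:
  assumes "obeys_lln cos"
  shows "mean_abs_covariance \<longlonglongrightarrow> 0"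
proof -
  let ?V = "\<lambda>n. \<integral>\<omega>. (sample_error n cos \<omega>)\<^sup>2 \<partial>M"
  have "?V \<longlonglongrightarrow> 0" using assms obeys_lln_iff_mean_square[of cos 1] by auto
  from tendsto_real_sqrt[OF tendsto_mult_left[OF this, of "2 * exp 1"]]
  have lim: "(\<lambda>n. sqrt (2 * exp 1 * ?V n)) \<longlonglongrightarrow> 0" by simp
  have "eventually (\<lambda>n. norm (mean_abs_covariance n) \<le> sqrt (2 * exp 1 * ?V n)) sequentially"
    using eventually_gt_at_top[of 0]
  proof eventually_elim
    case (elim n)
    let ?I = "{1..n} \<times> {1..n}"
    let ?c = "\<lambda>i j. (\<integral>\<omega>. cos (X i \<omega>) * cos (X j \<omega>) \<partial>M) - (\<integral>x. cos x \<partial>std_normal_distribution)\<^sup>2"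
    have V: "?V n = (\<Sum>i=1..n. \<Sum>j=1..n. ?c i j) / (real n)\<^sup>2"
      using elim by (subst integral_sample_error_square[where B = 1]) auto
    have factor: "(\<Sum>i=1..n. \<Sum>j=1..n. 2 * exp 1 * ?c i j) = 2 * exp 1 * (\<Sum>i=1..n. \<Sum>j=1..n. ?c i j)"
      by (simp only: sum_distrib_left)
    have "(\<Sum>i=1..n. \<Sum>j=1..n. \<bar>\<rho> i j\<bar>)\<^sup>2 \<le> (\<Sum>i=1..n. \<Sum>j=1..n. (\<rho> i j)\<^sup>2) * (real n)\<^sup>2"
      using sum_squared_le_sum_of_squares[of "\<lambda>(i, j). \<bar>\<rho> i j\<bar>" ?I]
      by (simp add: sum.cartesian_product case_prod_beta power2_eq_square[of "real n"])
    also have "\<dots> \<le> (\<Sum>i=1..n. \<Sum>j=1..n. 2 * exp 1 * ?c i j) * (real n)\<^sup>2"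
      by (intro mult_right_mono sum_mono cos_covariance_ge) auto
    also have "\<dots> = 2 * exp 1 * ?V n * ((real n)\<^sup>2)\<^sup>2"
    proof -
      have "2 * exp 1 * x * (real n)\<^sup>2 = 2 * exp 1 * (x / (real n)\<^sup>2) * ((real n)\<^sup>2)\<^sup>2" for x :: real
        using elim by (simp add: power2_eq_square)
      then show ?thesis unfolding V factor by blast
    qed
    finally have "(mean_abs_covariance n)\<^sup>2 \<le> 2 * exp 1 * ?V n"
      using elim unfolding mean_abs_covariance_def power_divide
      by (subst pos_divide_le_eq) auto
    moreover have "0 \<le> mean_abs_covariance n"
      unfolding mean_abs_covariance_def by (intro divide_nonneg_nonneg sum_nonneg) auto
    ultimately show ?case by (simp add: real_le_rsqrt)
  qed
  then show ?thesis by (rule Lim_null_comparison) (rule lim)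
qed

end

section \<open>The standard normal distribution function\<close>

lemma std_normal_interval_pos:
  assumes "a < b"
  shows "measure std_normal_distribution {a<..b} > 0"
proof -
  interpret real_distribution std_normal_distribution by (rule real_dist_normal_dist)
  have "emeasure std_normal_distribution {a<..b} \<noteq> 0"
  proof
    assume "emeasure std_normal_distribution {a<..b} = 0"
    then have "{a<..b} \<in> null_sets std_normal_distribution" by (auto simp: null_sets_def)
    then have "AE x in lborel. x \<in> {a<..b} \<longrightarrow> ennreal (std_normal_density x) = 0"
      by (subst (asm) null_sets_density_iff) auto
    then have "AE x in lborel. x \<notin> {a<..b}"
    proof eventually_elim
      case (elim x)
      have "std_normal_density x > 0" by (rule normal_density_pos) simp
      then show ?case using elim by auto
    qed
    then have "{a<..b} \<in> null_sets lborel" by (subst AE_iff_null_sets) auto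
    then show False using assms by (simp add: null_sets_def)
  qed
  then show ?thesis by (simp add: emeasure_eq_measure less_le)
qed

lemma strict_mono_std_normal_cdf: "strict_mono std_normal_cdf"
proof (rule strict_monoI)
  interpret real_distribution std_normal_distribution by (rule real_dist_normal_dist)
  fix a b :: real assume "a < b"
  then show "std_normal_cdf a < std_normal_cdf b"
    using cdf_diff_eq[of a b] std_normal_interval_pos[of a b] by (simp add: std_normal_cdf_def)
qed

lemma isCont_std_normal_cdf: "isCont std_normal_cdf x"
proof -
  interpret real_distribution std_normal_distribution by (rule real_dist_normal_dist)
  have "AE y in lborel. y \<in> {x} \<longrightarrow> ennreal (std_normal_density y) = 0"
    by (rule AE_mp[OF AE_lborel_singleton[of x]]) auto
  then have "{x} \<in> null_sets std_normal_distribution"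
    by (subst null_sets_density_iff) auto
  then have "measure std_normal_distribution {x} = 0" by (rule measure_eq_0_null_sets)
  then show ?thesis unfolding std_normal_cdf_def by (simp add: isCont_cdf)
qed

lemma std_normal_cdf_bounds: "0 < std_normal_cdf x" "std_normal_cdf x < 1"
proof -
  interpret real_distribution std_normal_distribution by (rule real_dist_normal_dist)
  have "0 \<le> std_normal_cdf (x - 1)" "std_normal_cdf (x + 1) \<le> 1"
    unfolding std_normal_cdf_def using cdf_nonneg cdf_bounded_prob by auto
  moreover have "std_normal_cdf (x - 1) < std_normal_cdf x" "std_normal_cdf x < std_normal_cdf (x + 1)"
    by (simp_all add: strict_mono_less[OF strict_mono_std_normal_cdf])
  ultimately show "0 < std_normal_cdf x" "std_normal_cdf x < 1" by linarith+
qed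

lemma std_normal_cdf_surj:
  assumes "0 < t" "t < 1"
  obtains a where "std_normal_cdf a = t"
proof -
  interpret real_distribution std_normal_distribution by (rule real_dist_normal_dist)
  obtain b where b: "t < std_normal_cdf b"
    using order_tendstoD(1)[OF cdf_lim_at_top_prob assms(2)]
    by (auto simp: std_normal_cdf_def eventually_at_top_linorder)
  obtain c where c: "std_normal_cdf c < t"
    using order_tendstoD(2)[OF cdf_lim_at_bot assms(1)]
    by (auto simp: std_normal_cdf_def eventually_at_bot_linorder)
  have "c \<le> b" using b c strict_mono_less[OF strict_mono_std_normal_cdf, of c b] by simp
  then have "\<exists>a\<ge>c. a \<le> b \<and> std_normal_cdf a = t"
    using b c isCont_std_normal_cdf by (intro IVT) auto
  then show thesis using that by blast
qed

text \<open>
  The probability integral transform: \<open>\<Phi>\<close> is a strictly increasing bijection onto \<open>(0, 1)\<close>, so \<open>\<Phi>(X)\<close> is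
  uniform.
\<close>
lemma measure_std_normal_cdf_le:
  "measure std_normal_distribution {x. std_normal_cdf x \<le> t} = max 0 (min 1 t)"
proof -
  interpret real_distribution std_normal_distribution by (rule real_dist_normal_dist)
  consider "t \<le> 0" | "t \<ge> 1" | "0 < t" "t < 1" by linarith
  then show ?thesis
  proof cases
    case 1
    then have "{x. std_normal_cdf x \<le> t} = {}"
      using std_normal_cdf_bounds(1) by (auto simp: not_le intro: le_less_trans)
    then show ?thesis using 1 by simp
  next
    case 2
    then have "{x. std_normal_cdf x \<le> t} = UNIV"
      using std_normal_cdf_bounds(2) by (auto intro: less_imp_le less_le_trans)
    then show ?thesis using 2 prob_space by simp
  next
    case 3
    then obtain a where a: "std_normal_cdf a = t" using std_normal_cdf_surj by blast
    then have "{x. std_normal_cdf x \<le> t} = {..a}"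
      using strict_mono_less_eq[OF strict_mono_std_normal_cdf, of _ a] by auto
    then show ?thesis using 3 a by (simp add: std_normal_cdf_def cdf_def)
  qed
qed

lemma measurable_std_normal_cdf [measurable]: "std_normal_cdf \<in> borel_measurable borel"
  by (intro borel_measurable_continuous_onI continuous_at_imp_continuous_on ballI isCont_std_normal_cdf)

section \<open>Deviations of the empirical distribution\<close>

context standardized_gaussian
begin

definition dev :: "nat \<Rightarrow> real \<Rightarrow> 'a \<Rightarrow> real" where
  "dev n t \<omega> = \<bar>empirical_distribution X n t \<omega> - (\<integral>\<xi>. empirical_distribution X n t \<xi> \<partial>M)\<bar>"

lemma integrable_indicator_cdf: "integrable std_normal_distribution (indicat_real {x. std_normal_cdf x \<le> t})"
  by (rule law.integrable_const_bound[of _ 1]) auto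

lemma empirical_distribution_eq:
  "empirical_distribution X n t \<omega> = (\<Sum>i=1..n. indicat_real {x. std_normal_cdf x \<le> t} (X i \<omega>)) / real n"
  by (simp add: empirical_distribution_def indicator_def of_bool_def)

text \<open>
  The empty sample has mean zero because \<open>1 / real 0 = 0\<close>.
\<close>
lemma expectation_empirical_distribution:
  "(\<integral>\<omega>. empirical_distribution X n t \<omega> \<partial>M) = (if n = 0 then 0 else max 0 (min 1 t))"
proof -
  have "has_bochner_integral M (\<lambda>\<omega>. (\<Sum>i=1..n. indicat_real {x. std_normal_cdf x \<le> t} (X i \<omega>)) / real n)
      ((\<Sum>i=1..n. max 0 (min 1 t)) / real n)"
  proof (intro has_bochner_integral_divide_zero has_bochner_integral_sum)
    fix i assume "i \<in> {1..n}"
    then show "has_bochner_integral M (\<lambda>\<omega>. indicat_real {x. std_normal_cdf x \<le> t} (X i \<omega>)) (max 0 (min 1 t))"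
      using integrable_comp[OF integrable_indicator_cdf, of i t]
        integral_comp[of "indicat_real {x. std_normal_cdf x \<le> t}" i]
      by (simp add: has_bochner_integral_iff measure_std_normal_cdf_le)
  qed
  then have "(\<integral>\<omega>. empirical_distribution X n t \<omega> \<partial>M) = (\<Sum>i=1..n. max 0 (min 1 t)) / real n"
    unfolding empirical_distribution_eq by (rule has_bochner_integral_integral_eq)
  then show ?thesis by (cases "n = 0") auto
qed

lemma dev_eq: "dev n t \<omega> = \<bar>empirical_distribution X n t \<omega> - (if n = 0 then 0 else max 0 (min 1 t))\<bar>"
  by (simp add: dev_def expectation_empirical_distribution)

lemma dev_eq_sample_error:
  assumes "n > 0"
  shows "dev n t \<omega> = \<bar>sample_error n (indicator {x. std_normal_cdf x \<le> t}) \<omega>\<bar>"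
  using assms
  by (simp add: dev_eq sample_error_def empirical_distribution_eq measure_std_normal_cdf_le)

lemma empirical_distribution_bounds: "0 \<le> empirical_distribution X n t \<omega>" "empirical_distribution X n t \<omega> \<le> 1"
proof -
  show "0 \<le> empirical_distribution X n t \<omega>"
    unfolding empirical_distribution_eq by (intro divide_nonneg_nonneg sum_nonneg) auto
  have "(\<Sum>i=1..n. indicat_real {x. std_normal_cdf x \<le> t} (X i \<omega>)) \<le> (\<Sum>i=1..n. 1)"
    by (rule sum_mono) (simp add: indicator_def)
  then show "empirical_distribution X n t \<omega> \<le> 1"
    unfolding empirical_distribution_eq by (cases "n = 0") auto
qed

lemma dev_nonneg: "0 \<le> dev n t \<omega>"
  by (simp add: dev_def)

lemma dev_le_1: "dev n t \<omega> \<le> 1"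
  unfolding dev_eq abs_le_iff using empirical_distribution_bounds[of n t \<omega>] by auto

lemma bdd_above_dev: "bdd_above (range (\<lambda>t. dev n t \<omega>))"
  by (rule bdd_aboveI2[of _ _ 1]) (rule dev_le_1)

lemma measurable_dev [measurable]: "dev n t \<in> borel_measurable M"
proof -
  have "(\<lambda>\<omega>. indicat_real {x. std_normal_cdf x \<le> t} (X i \<omega>)) \<in> borel_measurable M" if "i \<in> {1..n}" for i
    using integrable_comp[OF integrable_indicator_cdf, of i t] that by auto
  then show ?thesis
    unfolding dev_eq[abs_def] empirical_distribution_eq by (intro borel_measurable_abs borel_measurable_diff
      borel_measurable_divide borel_measurable_sum borel_measurable_const) auto
qed

text \<open>
  This makes the supremum over all \<open>t\<close> a countable one, and so its level sets measurable.
\<close>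
lemma dev_right_continuous: "((\<lambda>u. dev n u \<omega>) \<longlongrightarrow> dev n t \<omega>) (at_right t)"
proof -
  have step: "((\<lambda>u. of_bool (y \<le> u)) \<longlongrightarrow> (of_bool (y \<le> t) :: real)) (at_right t)" for y
  proof (rule tendsto_eventually)
    show "eventually (\<lambda>u. (of_bool (y \<le> u) :: real) = of_bool (y \<le> t)) (at_right t)"
    proof (cases "y \<le> t")
      case True
      then show ?thesis using eventually_at_right_less[of t] by (auto elim!: eventually_mono)
    next
      case False
      then show ?thesis
        by (auto simp: eventually_at_right_field intro!: exI[of _ y])
    qed
  qed
  show ?thesis
    unfolding dev_eq empirical_distribution_def
    by (intro tendsto_intros step) (auto intro!: tendsto_intros)
qed

lemma exceed_iff_rational: "(\<exists>t. dev n t \<omega> > \<epsilon>) \<longleftrightarrow> (\<exists>q\<in>\<rat>. dev n q \<omega> > \<epsilon>)"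
proof
  assume "\<exists>t. dev n t \<omega> > \<epsilon>"
  then obtain t where "dev n t \<omega> > \<epsilon>" ..
  from order_tendstoD(1)[OF dev_right_continuous this]
  obtain b where "b > t" and b: "\<And>y. t < y \<Longrightarrow> y < b \<Longrightarrow> dev n y \<omega> > \<epsilon>"
    unfolding eventually_at_right_field by blast
  then show "\<exists>q\<in>\<rat>. dev n q \<omega> > \<epsilon>" using Rats_dense_in_real[of t b] by blast
qed blast

lemma sup_dev_exceeds_iff: "(SUP t. dev n t \<omega>) > \<epsilon> \<longleftrightarrow> (\<exists>t. dev n t \<omega> > \<epsilon>)"
  by (subst less_cSUP_iff) (auto intro: bdd_above_dev)

lemma sup_exceed_measurable: "{\<omega> \<in> space M. (SUP t. dev n t \<omega>) > \<epsilon>} \<in> sets M"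
proof -
  have "{\<omega> \<in> space M. (SUP t. dev n t \<omega>) > \<epsilon>} = (\<Union>q\<in>\<rat>. {\<omega> \<in> space M. dev n q \<omega> > \<epsilon>})"
    unfolding sup_dev_exceeds_iff exceed_iff_rational by blast
  also have "\<dots> \<in> sets M"
    by (intro sets.countable_UN'' countable_rat) auto
  finally show ?thesis .
qed

text \<open>
  Comparing the two probabilities requires the event for the supremum to be measurable, since
  \<^const>\<open>measure\<close> is 0 on non-measurable sets.
\<close>
lemma uniform_imp_pointwise:
  assumes "(\<lambda>n. measure M {\<omega> \<in> space M. (SUP t. dev n t \<omega>) > \<epsilon>}) \<longlonglongrightarrow> 0"
  shows "(\<lambda>n. SUP t. measure M {\<omega> \<in> space M. dev n t \<omega> > \<epsilon>}) \<longlonglongrightarrow> 0"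
proof (rule Lim_null_comparison[OF always_eventually assms], intro allI)
  fix n
  have "(SUP t. measure M {\<omega> \<in> space M. dev n t \<omega> > \<epsilon>})
      \<le> measure M {\<omega> \<in> space M. (SUP t. dev n t \<omega>) > \<epsilon>}"
    by (intro cSUP_least finite_measure_mono sup_exceed_measurable) (auto simp: sup_dev_exceeds_iff)
  moreover have "0 \<le> (SUP t. measure M {\<omega> \<in> space M. dev n t \<omega> > \<epsilon>})"
    by (rule cSUP_upper2[of _ _ 0]) (auto intro: bdd_aboveI2[of _ _ 1])
  ultimately show "norm (SUP t. measure M {\<omega> \<in> space M. dev n t \<omega> > \<epsilon>})
      \<le> measure M {\<omega> \<in> space M. (SUP t. dev n t \<omega>) > \<epsilon>}" by simp
qed

text \<open>
  The deviations are at most 1, so convergence in probability gives convergence in mean. Since \<open>\<Phi>\<close> is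
  strictly increasing, the threshold \<open>\<Phi>(a)\<close> for \<open>\<Phi>(X)\<close> is the threshold \<open>a\<close> for \<open>X\<close>.
\<close>
lemma pointwise_imp_half_lines:
  assumes "\<And>\<epsilon>. \<epsilon> > 0 \<Longrightarrow> (\<lambda>n. SUP t. measure M {\<omega> \<in> space M. dev n t \<omega> > \<epsilon>}) \<longlonglongrightarrow> 0"
  shows "obeys_lln (indicator {..a})"
proof -
  define t where "t = std_normal_cdf a"
  have half_line: "{x. std_normal_cdf x \<le> t} = {..a}"
    using strict_mono_less_eq[OF strict_mono_std_normal_cdf, of _ a] by (auto simp: t_def)
  have "(\<lambda>n. \<integral>\<omega>. dev n t \<omega> \<partial>M) \<longlonglongrightarrow> 0"
  proof (rule LIMSEQ_I)
    fix e :: real assume e: "e > 0"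
    let ?P = "\<lambda>n t. measure M {\<omega> \<in> space M. dev n t \<omega> > e / 2}"
    obtain N where N: "\<And>n. n \<ge> N \<Longrightarrow> \<bar>SUP t. ?P n t\<bar> < e / 2"
      using LIMSEQ_D[OF assms, of "e / 2" "e / 2"] e by auto
    have "(\<integral>\<omega>. dev n t \<omega> \<partial>M) < e" if "n \<ge> N" for n
    proof -
      let ?A = "{\<omega> \<in> space M. dev n t \<omega> > e / 2}"
      have int: "integrable M (dev n t)"
        by (rule integrable_const_bound[of _ 1]) (auto simp: dev_nonneg dev_le_1)
      have "(\<integral>\<omega>. dev n t \<omega> \<partial>M) \<le> (\<integral>\<omega>. e / 2 + indicator ?A \<omega> \<partial>M)"
      proof (rule integral_mono[OF int])
        show "integrable M (\<lambda>\<omega>. e / 2 + indicat_real ?A \<omega>)"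
          by (rule integrable_const_bound[of _ "\<bar>e / 2\<bar> + 1"]) (auto simp: indicator_def)
        show "dev n t \<omega> \<le> e / 2 + indicat_real ?A \<omega>" if "\<omega> \<in> space M" for \<omega>
          using that e dev_le_1[of n t \<omega>] by (auto simp: indicator_def)
      qed
      also have "\<dots> = e / 2 + ?P n t"
        by (subst Bochner_Integration.integral_add) (auto simp: prob_space emeasure_eq_measure)
      also have "?P n t \<le> (SUP t. ?P n t)"
        by (rule cSUP_upper) (auto intro: bdd_aboveI2[of _ _ 1])
      finally show ?thesis using N[OF that] by linarith
    qed
    moreover have "0 \<le> (\<integral>\<omega>. dev n t \<omega> \<partial>M)" for n by (simp add: dev_nonneg)
    ultimately show "\<exists>N. \<forall>n\<ge>N. norm ((\<integral>\<omega>. dev n t \<omega> \<partial>M) - 0) < e" by auto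
  qed
  moreover have "eventually (\<lambda>n. (\<integral>\<omega>. dev n t \<omega> \<partial>M)
      = (\<integral>\<omega>. \<bar>sample_error n (indicator {..a}) \<omega>\<bar> \<partial>M)) sequentially"
    using eventually_gt_at_top[of 0]
    by eventually_elim (simp add: dev_eq_sample_error half_line)
  ultimately have "(\<lambda>n. \<integral>\<omega>. \<bar>sample_error n (indicator {..a}) \<omega>\<bar> \<partial>M) \<longlonglongrightarrow> 0"
    by (rule Lim_transform_eventually)
  then show ?thesis
    using integrable_indicator_cdf[of t] by (simp add: obeys_lln_def half_line)
qed

text \<open>
  The idea of Glivenko and Cantelli: the empirical distribution is monotone and its mean is the identity on
  \<open>[0, 1]\<close>, so between two neighbouring grid points the deviation grows by at most the mesh.
\<close>
lemma dev_le_grid: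
  assumes n: "n > 0" and m: "m > 0"
    and grid: "\<And>k. k \<le> m \<Longrightarrow> dev n (real k / real m) \<omega> \<le> e"
  shows "dev n t \<omega> \<le> e + 1 / real m"
proof -
  let ?F = "\<lambda>t. empirical_distribution X n t \<omega>"
  have mono: "?F s \<le> ?F u" if "s \<le> u" for s u
    unfolding empirical_distribution_def
    using that by (intro mult_left_mono sum_mono) (auto simp: of_bool_def)
  have e: "0 \<le> e" using order_trans[OF dev_nonneg grid[of 0]] by simp
  have at_grid: "\<bar>?F (real k / real m) - real k / real m\<bar> \<le> e" if "k \<le> m" for k
    using grid[OF that] that n m by (simp add: dev_eq divide_le_eq_1 min_absorb2)
  consider "t < 0" | "t \<ge> 1" | "0 \<le> t" "t < 1" by linarith
  then show ?thesis
  proof cases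
    case 1
    then have "\<not> std_normal_cdf x \<le> t" for x using std_normal_cdf_bounds(1)[of x] by linarith
    then have "?F t = 0" by (simp add: empirical_distribution_def)
    then show ?thesis using 1 n e by (simp add: dev_eq)
  next
    case 2
    then have "std_normal_cdf x \<le> t" for x using std_normal_cdf_bounds(2)[of x] by linarith
    then have "?F t = 1" using n by (simp add: empirical_distribution_def)
    then show ?thesis using 2 n e by (simp add: dev_eq)
  next
    case 3
    \<comment> \<open>The grid points \<open>k / m\<close> and \<open>(k + 1) / m\<close> enclose \<open>t\<close>.\<close>
    define k where "k = nat \<lfloor>t * real m\<rfloor>"
    have k: "real k \<le> t * real m" "t * real m < real k + 1"
      using 3 by (auto simp: k_def)
    then have "real k / real m \<le> t" "t < real (k + 1) / real m"
      using m by (auto simp: field_simps)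
    moreover have "k + 1 \<le> m"
    proof -
      have "t * real m < real m" using 3 m by simp
      then show ?thesis using k by linarith
    qed
    moreover have "real (k + 1) / real m = real k / real m + 1 / real m"
      by (simp add: add_divide_distrib)
    ultimately have "\<bar>?F t - t\<bar> \<le> e + 1 / real m"
      using at_grid[of k] at_grid[of "k + 1"] mono[of "real k / real m" t] mono[of t "real (k + 1) / real m"]
      unfolding abs_le_iff by linarith
    then show ?thesis using 3 n by (simp add: dev_eq)
  qed
qed

lemma obeys_lln_imp_uniform:
  assumes lln: "\<And>t. obeys_lln (indicator {x. std_normal_cdf x \<le> t})" and \<epsilon>: "\<epsilon> > 0"
  shows "(\<lambda>n. measure M {\<omega> \<in> space M. (SUP t. dev n t \<omega>) > \<epsilon>}) \<longlonglongrightarrow> 0"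
proof -
  \<comment> \<open>If every grid deviation is at most \<open>\<epsilon> / 2\<close>, a mesh of at most \<open>\<epsilon> / 4\<close> keeps all deviations below \<open>\<epsilon>\<close>.\<close>
  define m where "m = nat \<lceil>4 / \<epsilon>\<rceil>"
  have large: "4 / \<epsilon> \<le> real m" "4 / \<epsilon> > 0" using \<epsilon> by (auto simp: m_def)
  then have "real m > 0" by linarith
  then have m: "m > 0" "1 / real m \<le> \<epsilon> / 4" using \<epsilon> large(1) by (simp_all add: field_simps)
  let ?W = "\<lambda>n t. \<integral>\<omega>. \<bar>sample_error n (indicator {x. std_normal_cdf x \<le> t}) \<omega>\<bar> \<partial>M"
  show ?thesis
  proof (rule Lim_null_comparison)
    have "(\<lambda>n. \<Sum>k\<le>m. ?W n (real k / real m) / (\<epsilon> / 2)) \<longlonglongrightarrow> (\<Sum>k\<le>m. 0 / (\<epsilon> / 2))"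
      using lln \<epsilon> by (intro tendsto_sum tendsto_divide tendsto_const) (auto simp: obeys_lln_def)
    then show "(\<lambda>n. \<Sum>k\<le>m. ?W n (real k / real m) / (\<epsilon> / 2)) \<longlonglongrightarrow> 0" by simp
    show "eventually (\<lambda>n. norm (measure M {\<omega> \<in> space M. (SUP t. dev n t \<omega>) > \<epsilon>})
        \<le> (\<Sum>k\<le>m. ?W n (real k / real m) / (\<epsilon> / 2))) sequentially"
      using eventually_gt_at_top[of 0]
    proof eventually_elim
      case (elim n)
      let ?A = "\<lambda>k. {\<omega> \<in> space M. dev n (real k / real m) \<omega> \<ge> \<epsilon> / 2}"
      have "{\<omega> \<in> space M. (SUP t. dev n t \<omega>) > \<epsilon>} \<subseteq> (\<Union>k\<in>{..m}. ?A k)"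
      proof clarify
        fix \<omega> assume \<omega>: "\<omega> \<in> space M" "(SUP t. dev n t \<omega>) > \<epsilon>"
        then obtain t where t: "dev n t \<omega> > \<epsilon>" by (auto simp: sup_dev_exceeds_iff)
        show "\<omega> \<in> (\<Union>k\<in>{..m}. ?A k)"
        proof (rule ccontr)
          assume "\<not> ?thesis"
          then have "dev n (real k / real m) \<omega> \<le> \<epsilon> / 2" if "k \<le> m" for k
            using \<omega>(1) that by force
          from dev_le_grid[OF elim m(1) this, of t] t m(2) \<epsilon> show False by simp
        qed
      qed
      then have "measure M {\<omega> \<in> space M. (SUP t. dev n t \<omega>) > \<epsilon>} \<le> measure M (\<Union>k\<in>{..m}. ?A k)"
        by (intro finite_measure_mono) auto
      also have "\<dots> \<le> (\<Sum>k\<le>m. measure M (?A k))"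
        by (intro measure_UNION_le) auto
      also have "\<dots> \<le> (\<Sum>k\<le>m. ?W n (real k / real m) / (\<epsilon> / 2))"
      proof (rule sum_mono)
        fix k
        have "integrable M (dev n (real k / real m))"
          by (rule integrable_const_bound[of _ 1]) (auto simp: dev_nonneg dev_le_1)
        from integral_Markov_inequality_measure[OF this sets.empty_sets, of "\<epsilon> / 2"] \<epsilon>
        show "measure M (?A k) \<le> ?W n (real k / real m) / (\<epsilon> / 2)"
          by (simp add: dev_nonneg dev_eq_sample_error[OF elim])
      qed
      finally show ?case by simp
    qed
  qed
qed

theorem weak_dependence_characterization:
  "(weakly_dependent_normal M X \<longleftrightarrow>
      (\<forall>\<epsilon>>0. (\<lambda>n. SUP t. measure M {\<omega> \<in> space M. dev n t \<omega> > \<epsilon>}) \<longlonglongrightarrow> 0))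
   \<and> (weakly_dependent_normal M X \<longleftrightarrow>
      (\<forall>\<epsilon>>0. (\<lambda>n. measure M {\<omega> \<in> space M. (SUP t. dev n t \<omega>) > \<epsilon>}) \<longlonglongrightarrow> 0))"
  (is "(?i \<longleftrightarrow> ?ii) \<and> (?i \<longleftrightarrow> ?iii)")
proof -
  have "?iii" if "?i"
  proof -
    have "obeys_lln (indicator {..a})" for a
      using that weakly_dependent_iff by (intro half_line_lln weakly_dependent_imp_waves) simp
    then show ?thesis
      using obeys_lln_imp_uniform obeys_lln_integrable integrable_indicator_cdf by blast
  qed
  moreover have "?ii" if "?iii" using that uniform_imp_pointwise by blast
  moreover have "?i" if "?ii"
  proof -
    have "obeys_lln (indicator {..a})" for a using that by (intro pointwise_imp_half_lines) blast
    moreover have "integrable std_normal_distribution cos"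
      by (rule law.integrable_const_bound[of _ 1]) (auto simp: measurable_law)
    ultimately have "obeys_lln cos" by (rule obeys_lln_integrable)
    then show ?thesis using cos_lln_imp_weakly_dependent weakly_dependent_iff by blast
  qed
  ultimately show ?thesis by blast
qed

end

theorem corollary1:
  fixes M :: "'a measure" and X :: "nat \<Rightarrow> 'a \<Rightarrow> real"
  assumes "prob_space M"
    and "standardized_gaussian_process M X"
  defines "dev \<equiv> \<lambda>n t \<omega>. \<bar>empirical_distribution X n t \<omega>
                           - (\<integral>\<xi>. empirical_distribution X n t \<xi> \<partial>M)\<bar>"
  shows "(weakly_dependent_normal M X \<longleftrightarrow>
            (\<forall>\<epsilon>>0. (\<lambda>n. SUP t::real. measure M {\<omega> \<in> space M. dev n t \<omega> > \<epsilon>}) \<longlonglongrightarrow> 0))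
       \<and> (weakly_dependent_normal M X \<longleftrightarrow>
            (\<forall>\<epsilon>>0. (\<lambda>n. measure M {\<omega> \<in> space M. (SUP t::real. dev n t \<omega>) > \<epsilon>}) \<longlonglongrightarrow> 0))"
proof -
  interpret process: standardized_gaussian M X
    using assms(1,2)
    by (simp add: standardized_gaussian_def standardized_gaussian_axioms_def identically_distributed_def
        identically_distributed_axioms_def standardized_gaussian_process_def gaussian_process_def)
  have dev: "dev = process.dev" unfolding dev_def process.dev_def by (rule refl)
  show ?thesis unfolding dev by (rule process.weak_dependence_characterization)
qed

end
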